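(* Let $w$ satisfy (A1), fix $\delta\in(0,1/2)$, and suppose (A2) holds: $a_\delta(x)\ge \int_0^1 \widetilde w_\delta(x,y)\,dy$ for all $x\in\Omega$. Then $\widetilde{\mathcal N}_\delta:L^2(\Omega)\to L^2(\Omega)$ is invertible and there is $C=C(w,\delta)>0$ with $\|(\widetilde{\mathcal N}_\delta)^{-1}\|_{L^2\to L^2}\le C$; in particular, for every $f\in L^2(\Omega)$ the equation $\widetilde{\mathcal N}_\delta u=f$ has a unique solution $u\in L^2(\Omega)$.
   Context: Throughout, $\Omega=(0,1)$, $\delta\in(0,1/2)$ is the nonlocal horizon, $B_\delta(x)=(x-\delta,x+\delta)$, and $\chi_A$ denotes the indicator function of a set $A$. A function $w:[0,\infty)\to[0,\infty)$ satisfies (A1) if $w$ is continuous and nonincreasing on $[0,1)$, positive on $(0,1)$, $w(r)=0$ for $r\ge 1$, and $\int_{\mathbb R} w(|z|)|z|^2\,dz=2$. Set $w_\delta(x,y)=\delta^{-3}w(|x-y|/\delta)$, $a_\delta(x)=\int_0^1 w_\delta(x,y)\,dy$, and $b_\delta(x)=\frac{2}{(x+\delta)^2}\int_{x-\delta}^{0}(x-y)w_\delta(x,y)\,dy$ for $x\in(0,\delta)$, $b_\delta(x)=\frac{2}{(1-x+\delta)^2}\int_{1}^{x+\delta}(y-x)w_\delta(x,y)\,dy$ for $x\in(1-\delta,1)$, and $b_\delta(x)=0$ otherwise. The operator $\widetilde{\mathcal N}_\delta$ on $L^2(\Omega)$ is $\widetilde{\mathcal N}_\delta u(x)=a_\delta(x)u(x)-\int_0^1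 u(y)\big(w_\delta(x,y)-b_\delta(x)\chi_{[0,\delta]}(|y-x|)\big)\,dy$. (It is the integral form of the nonlocal Dirichlet problem $\mathcal L_\delta u-\mathcal M_\delta u=f$ in $\Omega$, $u=0$ on $(-\delta,0)\cup(1,1+\delta)$, where $\mathcal L_\delta u(x)=\int_{B_\delta(x)}(u(x)-u(y))w_\delta(x,y)dy$, $\mathcal M_\delta u(x)=\int_{B_\delta(x)\setminus\Omega}(u(x)+\mathcal G_\delta u(x)(y-x))w_\delta(x,y)dy$, and $\mathcal G_\delta u(x)=\frac{2}{(x+\delta)^2}\int_0^{x+\delta}u$ for $x\in(0,\delta)$, $\mathcal G_\delta u(x)=-\frac{2}{(1-x+\delta)^2}\int_{x-\delta}^1 u$ for $x\in(1-\delta,1)$, $0$ otherwise.) Define $\widetilde w_\delta(x,y)=|w_\delta(x,y)-b_\delta(x)\chi_{(0,\delta)}(|y-x|)|$. *)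

theory Defs
  imports "HOL-Analysis.Analysis"
begin

text \<open>Kernel assumption (A1). Only the values of w on [0,inf) matter.\<close>
definition A1 :: "(real \<Rightarrow> real) \<Rightarrow> bool" where
  "A1 w \<longleftrightarrow>
     (\<forall>r\<ge>0. w r \<ge> 0) \<and>
     continuous_on {0..<1} w \<and>
     (\<forall>r s. 0 \<le> r \<and> r \<le> s \<and> s < 1 \<longrightarrow> w s \<le> w r) \<and>
     (\<forall>r. 0 < r \<and> r < 1 \<longrightarrow> w r > 0) \<and>
     (\<forall>r\<ge>1. w r = 0) \<and>
     integrable lborel (\<lambda>z. w \<bar>z\<bar> * z\<^sup>2) \<and>
     (\<integral>z. w \<bar>z\<bar> * z\<^sup>2 \<partial>lborel) = 2"

definition wd :: "(real \<Rightarrow> real) \<Rightarrow> real \<Rightarrow> real \<Rightarrow> real \<Rightarrow> real" where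
  "wd w \<delta> x y = w (\<bar>x - y\<bar> / \<delta>) / \<delta> ^ 3"

definition ad :: "(real \<Rightarrow> real) \<Rightarrow> real \<Rightarrow> real \<Rightarrow> real" where
  "ad w \<delta> x = (LINT y:{0..1}|lborel. wd w \<delta> x y)"

definition bd :: "(real \<Rightarrow> real) \<Rightarrow> real \<Rightarrow> real \<Rightarrow> real" where
  "bd w \<delta> x =
     (if 0 < x \<and> x < \<delta> then
        2 / (x + \<delta>)\<^sup>2 * (LINT y:{x - \<delta>..0}|lborel. (x - y) * wd w \<delta> x y)
      else if 1 - \<delta> < x \<and> x < 1 then
        2 / (1 - x + \<delta>)\<^sup>2 * (LINT y:{1..x + \<delta>}|lborel. (y - x) * wd w \<delta> x y)
      else 0)"

text \<open>The operator tilde-N_delta (acting on representatives of L^2(0,1)).\<close>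
definition Nt :: "(real \<Rightarrow> real) \<Rightarrow> real \<Rightarrow> (real \<Rightarrow> real) \<Rightarrow> real \<Rightarrow> real" where
  "Nt w \<delta> u x = ad w \<delta> x * u x -
     (LINT y:{0..1}|lborel. u y * (wd w \<delta> x y
        - bd w \<delta> x * indicator {0..\<delta>} \<bar>y - x\<bar>))"

definition wtilde :: "(real \<Rightarrow> real) \<Rightarrow> real \<Rightarrow> real \<Rightarrow> real \<Rightarrow> real" where
  "wtilde w \<delta> x y = \<bar>wd w \<delta> x y - bd w \<delta> x * indicator {0<..<\<delta>} \<bar>y - x\<bar>\<bar>"

definition A2 :: "(real \<Rightarrow> real) \<Rightarrow> real \<Rightarrow> bool" where
  "A2 w \<delta> \<longleftrightarrow> (\<forall>x\<in>{0<..<1}. ad w \<delta> x \<ge> (LINT y:{0..1}|lborel. wtilde w \<delta> x y))"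

text \<open>Representatives of elements of L^2(0,1) and their norm.\<close>
definition L2 :: "(real \<Rightarrow> real) set" where
  "L2 = {u. u \<in> borel_measurable lborel \<and> set_integrable lborel {0<..<1} (\<lambda>x. (u x)\<^sup>2)}"

definition L2norm :: "(real \<Rightarrow> real) \<Rightarrow> real" where
  "L2norm u = sqrt (LINT x:{0<..<1}|lborel. (u x)\<^sup>2)"

text \<open>Equality almost everywhere on Omega = (0,1), i.e. equality in L^2(0,1).\<close>
definition ae_eq :: "(real \<Rightarrow> real) \<Rightarrow> (real \<Rightarrow> real) \<Rightarrow> bool" where
  "ae_eq u v \<longleftrightarrow> (AE x in lborel. x \<in> {0<..<1} \<longrightarrow> u x = v x)"

end

theory Submission
  imports Defs "HOL-Complex_Analysis.Great_Picard"
begin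

text \<open>
  Write the operator as \<open>a u - K u\<close>, with \<open>a\<close> continuous and positive on \<open>[0,1]\<close> and \<open>K\<close> the integral
  operator with the signed kernel. With \<open>u = f / a + h\<close> the equation \<open>a u - K u = f\<close> becomes
  \<open>h - S h = K (f / a) / a\<close> for a continuous function \<open>h\<close>, where \<open>S h = K h / a\<close>. By (A2) the operator
  \<open>S\<close> has norm at most 1 on \<open>C[0,1]\<close>, and it is compact by Arzela--Ascoli. If \<open>S h = h\<close>, then (A2) is sharp at
  a maximum point of \<open>|h|\<close>; as the kernel is positive near the diagonal, \<open>h\<close> is locally constant there, hence
  constant, and testing the equation at a point with \<open>b > 0\<close> gives \<open>h = 0\<close>. So \<open>1 - S\<close> is bounded below, and
  it is onto because the equations \<open>h - t S h = g\<close> with \<open>t < 1\<close> are solved by contraction and their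
  solutions, being bounded, converge along a sequence \<open>t \<rightarrow> 1\<close>.
\<close>

section \<open>Compact nonexpansive operators\<close>

text \<open>Otherwise there are unit vectors \<open>v n\<close> with \<open>v n - T (v n)\<close>
  tending to 0. Compactness makes \<open>T (v n)\<close> converge along a subsequence, so
  \<open>v n\<close> converges to the same limit, a fixed point of norm 1.\<close>

lemma compact_operator_bounded_below:
  fixes T :: "'a::real_normed_vector \<Rightarrow> 'a"
  assumes lin: "bounded_linear T"
    and compact: "\<And>v :: nat \<Rightarrow> 'a. bounded (range v) \<Longrightarrow> \<exists>l r. strict_mono r \<and> (\<lambda>n. T (v (r n))) \<longlonglongrightarrow> l"
    and inj: "\<And>x. T x = x \<Longrightarrow> x = 0"
  shows "\<exists>c>0. \<forall>h. norm h \<le> c * norm (h - T h)"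
proof (rule ccontr)
  interpret T: bounded_linear T by fact
  assume neg: "\<not> ?thesis"
  have "\<exists>v. norm v = 1 \<and> norm (v - T v) \<le> 1 / real (Suc n)" for n
  proof -
    from neg obtain h where h: "norm h > real (Suc n) * norm (h - T h)"
      by (metis not_le of_nat_0_less_iff zero_less_Suc)
    then have pos: "norm h > 0"
      by (smt (verit) mult_nonneg_nonneg norm_ge_zero of_nat_0_le_iff)
    have "norm (h /\<^sub>R norm h - T (h /\<^sub>R norm h)) = norm (h - T h) / norm h"
      by (simp add: T.scaleR flip: scaleR_diff_right) (simp add: divide_inverse mult.commute)
    also have "\<dots> \<le> 1 / real (Suc n)"
      using h pos by (simp add: field_simps)
    finally show ?thesis
      using pos by (intro exI[of _ "h /\<^sub>R norm h"]) auto
  qed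
  then obtain v where v1: "\<And>n. norm (v n) = 1" and v: "\<And>n. norm (v n - T (v n)) \<le> 1 / real (Suc n)"
    by metis
  have "bounded (range v)"
    using v1 by (auto simp: bounded_iff intro!: exI[of _ 1])
  then obtain l r where r: "strict_mono r" and l: "(\<lambda>n. T (v (r n))) \<longlonglongrightarrow> l"
    using compact by blast
  have "(\<lambda>n. v n - T (v n)) \<longlonglongrightarrow> 0"
    using v by (intro Lim_null_comparison[OF _ LIMSEQ_Suc[OF lim_1_over_n]]) auto
  then have "(\<lambda>n. v (r n) - T (v (r n))) \<longlonglongrightarrow> 0"
    using LIMSEQ_subseq_LIMSEQ[OF _ r] by (fastforce simp: o_def)
  from tendsto_add[OF this l] have vl: "(\<lambda>n. v (r n)) \<longlonglongrightarrow> l"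
    by simp
  have "T l = l"
    using LIMSEQ_unique[OF T.tendsto[OF vl] l] .
  moreover have "norm l = 1"
    using LIMSEQ_unique[OF tendsto_norm[OF vl]] v1 by simp
  ultimately show False
    using inj by force
qed

text \<open>Nonexpansiveness turns \<open>(1 - s) T\<close> into a contraction and, together with
  the lower bound for \<open>1 - T\<close>, keeps its solutions bounded while \<open>s\<close> tends
  to 0.\<close>

lemma compact_nonexpansive_solvable:
  fixes T :: "'a::{real_normed_vector,complete_space} \<Rightarrow> 'a"
  assumes lin: "bounded_linear T"
    and nonexp: "\<And>x. norm (T x) \<le> norm x"
    and compact: "\<And>v :: nat \<Rightarrow> 'a. bounded (range v) \<Longrightarrow> \<exists>l r. strict_mono r \<and> (\<lambda>n. T (v (r n))) \<longlonglongrightarrow> l"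
    and inj: "\<And>x. T x = x \<Longrightarrow> x = 0"
  shows "\<exists>c>0. \<forall>g. \<exists>h. h - T h = g \<and> norm h \<le> c * norm g"
proof -
  interpret T: bounded_linear T by fact
  obtain c where c: "c > 0" and below: "\<And>h. norm h \<le> c * norm (h - T h)"
    using compact_operator_bounded_below[OF lin compact inj] by blast
  have "\<exists>h. h - T h = g" for g
  proof -
    \<comment> \<open>chosen so that the defect \<open>s n *\<^sub>R T (u n)\<close> is absorbed by the lower bound: \<open>c * s n \<le> 1 / 2\<close>\<close>
    define s where "s n = 1 / (real n + 2 * c + 2)" for n
    have s: "0 < s n" "s n < 1" "c * s n \<le> 1 / 2" for n
      using c by (auto simp: s_def field_simps)
    have "\<exists>u. (1 - s n) *\<^sub>R T u + g = u" for n
    proof -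
      have "dist ((1 - s n) *\<^sub>R T x + g) ((1 - s n) *\<^sub>R T y + g) \<le> (1 - s n) * dist x y" for x y
        using nonexp[of "x - y"] s[of n]
        by (simp add: dist_norm T.diff flip: scaleR_diff_right)
      then have "\<exists>!u. (1 - s n) *\<^sub>R T u + g = u"
        using s[of n] by (intro banach_fix_type[of "1 - s n"]) auto
      then show ?thesis by blast
    qed
    then obtain u where u: "\<And>n. (1 - s n) *\<^sub>R T (u n) + g = u n"
      by metis
    have ub: "norm (u n) \<le> 2 * c * norm g" for n
    proof -
      have "u n - T (u n) = g - s n *\<^sub>R T (u n)"
        by (subst u[symmetric, of n]) (simp add: algebra_simps)
      then have "norm (u n) \<le> c * (norm g + s n * norm (u n))"
        using below[of "u n"] norm_triangle_ineq4[of g "s n *\<^sub>R T (u n)"] nonexp[of "u n"] s[of n] c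
        by (smt (verit) mult_left_mono norm_scaleR)
      also have "\<dots> \<le> c * norm g + 1 / 2 * norm (u n)"
        using mult_right_mono[OF s(3)[of n], of "norm (u n)"] by (simp add: algebra_simps)
      finally show ?thesis by simp
    qed
    then have "bounded (range u)"
      by (auto simp: bounded_iff)
    then obtain l r where r: "strict_mono r" and l: "(\<lambda>n. T (u (r n))) \<longlonglongrightarrow> l"
      using compact by blast
    have "s \<longlonglongrightarrow> 0"
      using c by (intro Lim_null_comparison[OF _ LIMSEQ_Suc[OF lim_1_over_n]])
        (auto simp: s_def intro!: always_eventually divide_left_mono)
    then have "(\<lambda>n. s (r n)) \<longlonglongrightarrow> 0"
      using LIMSEQ_subseq_LIMSEQ[OF _ r] by (fastforce simp: o_def)
    \<comment> \<open>By the fixed point equation these terms are the \<open>u (r n)\<close>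
      themselves, so convergence of the images forces convergence of the solutions.\<close>
    then have "(\<lambda>n. (1 - s (r n)) *\<^sub>R T (u (r n)) + g) \<longlonglongrightarrow> (1 - 0) *\<^sub>R l + g"
      by (intro tendsto_intros l)
    then have ul: "(\<lambda>n. u (r n)) \<longlonglongrightarrow> l + g"
      by (simp add: u)
    from LIMSEQ_unique[OF T.tendsto[OF this] l] have "T (l + g) = l" .
    then show ?thesis
      by (intro exI[of _ "l + g"]) simp
  qed
  then show ?thesis
    using c below by metis
qed

section \<open>Integral operators on the unit interval\<close>

text \<open>\<open>ad\<close> and \<open>Nt\<close> integrate over the closed interval while
  \<open>L2\<close> and \<open>ae_eq\<close> refer to the open one; the end points form a null
  set.\<close>

lemma AE_indicator_unit_Icc_Ioo:
  "AE x in lborel. (indicator {0..1} x :: real) = indicator {0<..<1} (x :: real)"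
  using AE_lborel_singleton[of "0 :: real"] AE_lborel_singleton[of "1 :: real"]
  by eventually_elim (auto simp: indicator_def)

lemma set_integral_unit_Icc_Ioo:
  fixes f :: "real \<Rightarrow> real"
  assumes [measurable]: "f \<in> borel_measurable lborel"
  shows "(LINT x:{0..1}|lborel. f x) = (LINT x:{0<..<1}|lborel. f x)"
  unfolding set_lebesgue_integral_def
  using AE_indicator_unit_Icc_Ioo by (intro integral_cong_AE) auto

lemma set_integrable_unit_Icc_Ioo:
  fixes f :: "real \<Rightarrow> real"
  assumes [measurable]: "f \<in> borel_measurable lborel"
  shows "set_integrable lborel {0..1} f \<longleftrightarrow> set_integrable lborel {0<..<1} f"
  unfolding set_integrable_def
  using AE_indicator_unit_Icc_Ioo by (intro integrable_cong_AE) auto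

lemma set_integrable_const_unit [simp]:
  "set_integrable lborel {0..1 :: real} (\<lambda>_. c :: real)"
  by (intro borel_integrable_atLeastAtMost') simp

lemma set_integral_const_unit [simp]: "(LINT x:{0..1 :: real}|lborel. c :: real) = c"
  by (simp add: set_lebesgue_integral_def)

lemma set_integral_mono_unit:
  fixes f g :: "real \<Rightarrow> real"
  assumes "set_integrable lborel {0..1} f" "set_integrable lborel {0..1} g"
    and "\<And>x. x \<in> {0..1} \<Longrightarrow> f x \<le> g x"
  shows "(LINT x:{0..1}|lborel. f x) \<le> (LINT x:{0..1}|lborel. g x)"
  using assms by (intro set_integral_mono) auto

section \<open>Integral operators with a bounded kernel, continuous in the first variable\<close>

text \<open>Continuity in \<open>x\<close> for every \<open>y\<close> would be too much to ask, as
  the Dirichlet kernel may jump at distance \<delta>. Convergence for almost every \<open>y\<close>,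
  with a null set depending on the sequence and its limit, is enough for dominated
  convergence.\<close>

locale continuous_kernel =
  fixes k :: "real \<Rightarrow> real \<Rightarrow> real" and B :: real
  assumes k_measurable: "\<And>x. x \<in> {0..1} \<Longrightarrow> k x \<in> borel_measurable lborel"
    and k_bound: "\<And>x y. x \<in> {0..1} \<Longrightarrow> \<bar>k x y\<bar> \<le> B"
    and k_tendsto: "\<And>X x. (\<And>n. X n \<in> {0..1}) \<Longrightarrow> x \<in> {0..1} \<Longrightarrow> X \<longlonglongrightarrow> x \<Longrightarrow>
      AE y in lborel. (\<lambda>n. k (X n) y) \<longlonglongrightarrow> k x y"
begin

definition K :: "(real \<Rightarrow> real) \<Rightarrow> real \<Rightarrow> real" where
  "K u x = (LINT y:{0..1}|lborel. k x y * u y)"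

lemma B_nonneg: "0 \<le> B"
  using k_bound[of 0 0] by simp

lemma integrable_k:
  assumes x: "x \<in> {0..1}" and u: "set_integrable lborel {0..1} u"
  shows "set_integrable lborel {0..1} (\<lambda>y. k x y * u y)"
proof -
  note [measurable] = k_measurable[OF x]
  have [measurable]: "(\<lambda>y. indicator {0..1} y * u y) \<in> borel_measurable lborel"
    using borel_measurable_integrable[OF u[unfolded set_integrable_def]] by simp
  have "(\<lambda>y. k x y * (indicator {0..1} y * u y)) \<in> borel_measurable lborel"
    by measurable
  then have m: "(\<lambda>y. indicator {0..1} y * (k x y * u y)) \<in> borel_measurable lborel"
    by (simp add: mult.left_commute)
  have "integrable lborel (\<lambda>y. B * (indicator {0..1} y * u y))"
    using u unfolding set_integrable_def by simp
  then show ?thesis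
    unfolding set_integrable_def real_scaleR_def using m
    by (rule Bochner_Integration.integrable_bound)
      (auto simp: indicator_def abs_mult B_nonneg intro!: mult_right_mono k_bound[OF x])
qed

text \<open>Dominated convergence with majorant \<open>B * |u|\<close>. Integrability of
  \<open>u\<close> suffices, so \<open>K\<close> maps L^2 into the continuous functions; this is
  what makes the correction \<open>h\<close> continuous.\<close>

lemma continuous_K:
  assumes u: "set_integrable lborel {0..1} u"
  shows "continuous_on {0..1} (K u)"
  unfolding continuous_on_sequentially
proof (intro allI ballI impI, elim conjE)
  fix X :: "nat \<Rightarrow> real" and x :: real
  assume x: "x \<in> {0..1}" and X: "\<forall>n. X n \<in> {0..1}" and lim: "X \<longlonglongrightarrow> x"
  have int: "integrable lborel (\<lambda>y. indicator {0..1} y * (k x y * u y))"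
    if "x \<in> {0..1}" for x
    using integrable_k[OF that u] by (simp add: set_integrable_def)
  have "(\<lambda>n. LINT y|lborel. indicator {0..1} y * (k (X n) y * u y)) \<longlonglongrightarrow>
      (LINT y|lborel. indicator {0..1} y * (k x y * u y))"
  proof (rule integral_dominated_convergence)
    show "integrable lborel (\<lambda>y. B * \<bar>indicator {0..1} y * u y\<bar>)"
      using u unfolding set_integrable_def by simp
    show "AE y in lborel. (\<lambda>n. indicator {0..1} y * (k (X n) y * u y)) \<longlonglongrightarrow>
        indicator {0..1} y * (k x y * u y)"
      using k_tendsto[OF X[rule_format] x lim] by eventually_elim (intro tendsto_intros)
    show "AE y in lborel. norm (indicator {0..1} y * (k (X n) y * u y)) \<le>
        B * \<bar>indicator {0..1} y * u y\<bar>" for n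
      using k_bound[OF X[rule_format]]
      by (auto simp: indicator_def abs_mult intro!: mult_right_mono)
  qed (use int x X in \<open>auto dest: borel_measurable_integrable\<close>)
  then show "(K u \<circ> X) \<longlonglongrightarrow> K u x"
    by (simp add: K_def set_lebesgue_integral_def o_def)
qed

lemma K_bound:
  assumes x: "x \<in> {0..1}" and u: "set_integrable lborel {0..1} u"
  shows "\<bar>K u x\<bar> \<le> B * (LINT y:{0..1}|lborel. \<bar>u y\<bar>)"
proof -
  have "\<bar>K u x\<bar> \<le> (LINT y:{0..1}|lborel. \<bar>k x y * u y\<bar>)"
    unfolding K_def using set_integral_norm_bound[OF integrable_k[OF x u]] by simp
  also have "\<dots> \<le> (LINT y:{0..1}|lborel. B * \<bar>u y\<bar>)"
    using set_integrable_abs[OF integrable_k[OF x u]] set_integrable_abs[OF u] k_bound[OF x]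
    by (intro set_integral_mono_unit) (auto simp: abs_mult intro!: mult_right_mono)
  finally show ?thesis by simp
qed

lemma K_add:
  assumes "x \<in> {0..1}" "set_integrable lborel {0..1} u" "set_integrable lborel {0..1} v"
  shows "K (\<lambda>y. u y + v y) x = K u x + K v x"
  unfolding K_def using assms integrable_k by (simp add: distrib_left set_integral_add)

lemma K_scale: "K (\<lambda>y. c * u y) x = c * K u x"
  by (simp add: K_def mult.left_commute)

lemma K_cong_AE:
  assumes x: "x \<in> {0..1}" and [measurable]: "u \<in> borel_measurable lborel" "v \<in> borel_measurable lborel"
    and ae: "ae_eq u v"
  shows "K u x = K v x"
proof -
  note [measurable] = k_measurable[OF x]
  show ?thesis
    unfolding K_def set_lebesgue_integral_def
  proof (rule integral_cong_AE)
    show "AE y in lborel. indicator {0..1} y *\<^sub>R (k x y * u y) = indicator {0..1} y *\<^sub>R (k x y * v y)"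
      using ae[unfolded ae_eq_def] AE_indicator_unit_Icc_Ioo
      by eventually_elim (auto simp: indicator_def)
  qed measurable
qed

lemma continuous_kernel_abs: "continuous_kernel (\<lambda>x y. \<bar>k x y\<bar>) B"
proof
  show "AE y in lborel. (\<lambda>n. \<bar>k (X n) y\<bar>) \<longlonglongrightarrow> \<bar>k x y\<bar>"
    if "\<And>n. X n \<in> {0..1}" "x \<in> {0..1}" "X \<longlonglongrightarrow> x" for X x
    using k_tendsto[OF that] by eventually_elim (intro tendsto_intros)
qed (use k_bound k_measurable in auto)

lemma continuous_kernel_abs_diff:
  assumes x: "x \<in> {0..1}"
  shows "continuous_kernel (\<lambda>x' y. \<bar>k x y - k x' y\<bar>) (2 * B)"
proof
  show "(\<lambda>y. \<bar>k x y - k x' y\<bar>) \<in> borel_measurable lborel" if "x' \<in> {0..1}" for x'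
    using k_measurable[OF x] k_measurable[OF that] by measurable
  show "\<bar>\<bar>k x y - k x' y\<bar>\<bar> \<le> 2 * B" if "x' \<in> {0..1}" for x' y
    using k_bound[OF x, of y] k_bound[OF that, of y] by linarith
  show "AE y in lborel. (\<lambda>n. \<bar>k x y - k (X n) y\<bar>) \<longlonglongrightarrow> \<bar>k x y - k x' y\<bar>"
    if "\<And>n. X n \<in> {0..1}" "x' \<in> {0..1}" "X \<longlonglongrightarrow> x'" for X x'
    using k_tendsto[OF that] by eventually_elim (intro tendsto_intros)
qed

lemma integrable_kernel: "x \<in> {0..1} \<Longrightarrow> set_integrable lborel {0..1} (k x)"
  using integrable_k[of x "\<lambda>_. 1"] by simp

text \<open>The radius \<open>d\<close> depends on \<open>x\<close> and \<open>e\<close> but not on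
  \<open>h\<close>. The integral of \<open>|k x y - k x' y|\<close> over \<open>y\<close> is
  continuous in \<open>x'\<close>, being given by a kernel of the same kind, and it vanishes at
  \<open>x' = x\<close>.\<close>

lemma K_equicontinuous:
  assumes x: "x \<in> {0..1}" and e: "0 < e"
  obtains d where "0 < d"
    and "\<And>x' h M. x' \<in> {0..1} \<Longrightarrow> \<bar>x' - x\<bar> < d \<Longrightarrow> set_integrable lborel {0..1} h \<Longrightarrow>
      (\<And>y. y \<in> {0..1} \<Longrightarrow> \<bar>h y\<bar> \<le> M) \<Longrightarrow> \<bar>K h x - K h x'\<bar> \<le> M * e"
proof -
  interpret D: continuous_kernel "\<lambda>x' y. \<bar>k x y - k x' y\<bar>" "2 * B"
    using continuous_kernel_abs_diff[OF x] .
  have "continuous_on {0..1} (D.K (\<lambda>_. 1))"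
    by (intro D.continuous_K) simp
  moreover have D0: "D.K (\<lambda>_. 1) x = 0"
    by (simp add: D.K_def)
  ultimately obtain d where d: "0 < d"
    "\<And>x'. x' \<in> {0..1} \<Longrightarrow> \<bar>x' - x\<bar> < d \<Longrightarrow> D.K (\<lambda>_. 1) x' < e"
    using x e unfolding continuous_on_iff dist_real_def by fastforce
  show thesis
  proof
    fix x' M :: real and h :: "real \<Rightarrow> real"
    assume x': "x' \<in> {0..1}" "\<bar>x' - x\<bar> < d" and h: "set_integrable lborel {0..1} h"
      and M: "\<And>y. y \<in> {0..1} \<Longrightarrow> \<bar>h y\<bar> \<le> M"
    have "\<bar>h 0\<bar> \<le> M" by (intro M) simp
    then have M0: "0 \<le> M" by linarith
    note int = set_integral_diff(1)[OF integrable_k[OF x h] integrable_k[OF x'(1) h]]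
    have "K h x - K h x' = (LINT y:{0..1}|lborel. k x y * h y - k x' y * h y)"
      unfolding K_def using set_integral_diff(2)[OF integrable_k[OF x h] integrable_k[OF x'(1) h]] by simp
    also have "\<bar>\<dots>\<bar> \<le> (LINT y:{0..1}|lborel. \<bar>k x y * h y - k x' y * h y\<bar>)"
      using set_integral_norm_bound[OF int] by simp
    also have "\<dots> \<le> (LINT y:{0..1}|lborel. M * \<bar>k x y - k x' y\<bar>)"
      using set_integrable_abs[OF int] D.integrable_kernel[OF x'(1)] M
      by (intro set_integral_mono_unit)
        (auto simp: abs_mult mult.commute[of M] simp flip: left_diff_distrib
          simp del: abs_mult_self_eq intro!: mult_left_mono)
    also have "\<dots> = M * D.K (\<lambda>_. 1) x'"
      by (simp add: D.K_def)
    also have "\<dots> \<le> M * e"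
      using d(2)[OF x'] M0 by (intro mult_left_mono) auto
    finally show "\<bar>K h x - K h x'\<bar> \<le> M * e" .
  qed fact
qed

end

text \<open>Extending by constants embeds \<open>C[0,1]\<close> into the library's Banach space of bounded continuous functions
  on the whole line.\<close>
definition unit_ext :: "(real \<Rightarrow> real) \<Rightarrow> (real \<Rightarrow>\<^sub>C real)" where
  "unit_ext f = Bcontfun (\<lambda>x. f (clamp 0 1 x))"

lemma clamp_unit_mem: "clamp 0 1 x \<in> {0..1}" for x :: real
  using clamp_in_interval[of 0 1 x] by simp

lemmas clamp_unit_bounds [simp] = clamp_unit_mem[unfolded atLeastAtMost_iff, THEN conjunct1]
  clamp_unit_mem[unfolded atLeastAtMost_iff, THEN conjunct2]

lemma clamp_unit [simp]: "x \<in> {0..1} \<Longrightarrow> clamp 0 1 x = x" for x :: real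
  using clamp_cancel_cbox[of x 0 1] by simp

lemma unit_ext_apply:
  assumes "continuous_on {0..1} f"
  shows "unit_ext f x = f (clamp 0 1 x)"
proof -
  obtain g :: "real \<Rightarrow>\<^sub>C real" where "\<And>x. g x = f (clamp 0 1 x)"
    using continuous_on_cbox_bcontfunE[of 0 1 f] assms by auto
  then have "apply_bcontfun g = (\<lambda>x. f (clamp 0 1 x))" by auto
  then show ?thesis
    unfolding unit_ext_def by (metis apply_bcontfun_inverse)
qed

section \<open>L^1 and L^2 bounds on the unit interval\<close>

text \<open>Integrability follows since \<open>1 + f^2\<close> dominates \<open>|f|\<close>. The
  norm bound is Cauchy-Schwarz against the constant 1: with \<open>m\<close> the L^1 norm,
  integrating \<open>2 m |f| \<le> f^2 + m^2\<close> bounds \<open>2 m^2\<close> by the squared L^2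
  norm plus \<open>m^2\<close>.\<close>

lemma L2_integrable:
  assumes "f \<in> L2"
  shows "set_integrable lborel {0..1} f"
    and "(LINT x:{0..1}|lborel. \<bar>f x\<bar>) \<le> L2norm f"
proof -
  have [measurable]: "f \<in> borel_measurable lborel"
    and sq: "set_integrable lborel {0..1} (\<lambda>x. (f x)\<^sup>2)"
    using assms by (auto simp: L2_def set_integrable_unit_Icc_Ioo)
  have "set_integrable lborel {0..1} (\<lambda>x. 1 + (f x)\<^sup>2)"
    using sq by (intro set_integral_add) auto
  then show int: "set_integrable lborel {0..1} f"
    unfolding set_integrable_def real_scaleR_def
  proof (rule Bochner_Integration.integrable_bound)
    have "\<bar>t\<bar> \<le> 1 + t\<^sup>2" for t :: real
      using sum_squares_bound[of "\<bar>t\<bar>" 1] by simp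
    then show "AE x in lborel. norm (indicator {0..1} x * f x) \<le> norm (indicator {0..1} x * (1 + (f x)\<^sup>2))"
      by (auto simp: indicator_def intro!: AE_I2)
  qed measurable
  define m where "m = (LINT x:{0..1}|lborel. \<bar>f x\<bar>)"
  have m0: "0 \<le> m"
    unfolding m_def set_lebesgue_integral_def by (intro integral_nonneg_AE) auto
  have int': "set_integrable lborel {0..1} (\<lambda>x. 2 * m * \<bar>f x\<bar>)"
    using set_integrable_abs[OF int] by simp
  have "2 * m * m = (LINT x:{0..1}|lborel. 2 * m * \<bar>f x\<bar>)"
    by (simp add: m_def)
  also have "\<dots> \<le> (LINT x:{0..1}|lborel. (f x)\<^sup>2 + m\<^sup>2)"
  proof (intro set_integral_mono_unit int')
    show "set_integrable lborel {0..1} (\<lambda>x. (f x)\<^sup>2 + m\<^sup>2)"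
      using sq by (intro set_integral_add) auto
    show "2 * m * \<bar>f x\<bar> \<le> (f x)\<^sup>2 + m\<^sup>2" for x
      using sum_squares_bound[of m "\<bar>f x\<bar>"] by (simp add: add.commute)
  qed
  also have "\<dots> = (LINT x:{0..1}|lborel. (f x)\<^sup>2) + m\<^sup>2"
    using sq by (subst set_integral_add) auto
  finally have "m\<^sup>2 \<le> (LINT x:{0<..<1}|lborel. (f x)\<^sup>2)"
    by (simp add: set_integral_unit_Icc_Ioo power2_eq_square)
  then show "m \<le> L2norm f"
    unfolding L2norm_def by (rule real_le_rsqrt)
qed

lemma L2norm_nonneg: "0 \<le> L2norm f"
  unfolding L2norm_def set_lebesgue_integral_def by (auto intro!: integral_nonneg_AE)

text \<open>Made for functions \<open>f / a + h\<close> with \<open>h\<close> bounded. The factor 2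
  generously covers the square root of 2 that arises from
  \<open>(p + q)^2 \<le> 2 p^2 + 2 q^2\<close>.\<close>

lemma L2_bounded_by:
  assumes f: "f \<in> L2" and [measurable]: "u \<in> borel_measurable lborel"
    and A: "0 \<le> A" "0 \<le> D"
    and bd: "\<And>x. x \<in> {0..1} \<Longrightarrow> \<bar>u x\<bar> \<le> A * \<bar>f x\<bar> + D"
  shows "u \<in> L2" and "L2norm u \<le> 2 * (A * L2norm f + D)"
proof -
  have [measurable]: "f \<in> borel_measurable lborel"
    and sq: "set_integrable lborel {0..1} (\<lambda>x. (f x)\<^sup>2)"
    using f by (auto simp: L2_def set_integrable_unit_Icc_Ioo)
  have le: "(u x)\<^sup>2 \<le> 2 * A\<^sup>2 * (f x)\<^sup>2 + 2 * D\<^sup>2" if "x \<in> {0..1}" for x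
  proof -
    have "(u x)\<^sup>2 \<le> (A * \<bar>f x\<bar> + D)\<^sup>2"
      using power_mono[OF bd[OF that], of 2] by simp
    also have "\<dots> \<le> 2 * (A * \<bar>f x\<bar>)\<^sup>2 + 2 * D\<^sup>2"
      using sum_squares_bound[of "A * \<bar>f x\<bar>" D] by (simp add: power2_sum)
    finally show ?thesis by (simp add: power_mult_distrib)
  qed
  have int: "set_integrable lborel {0..1} (\<lambda>x. 2 * A\<^sup>2 * (f x)\<^sup>2 + 2 * D\<^sup>2)"
    using sq by (intro set_integral_add) auto
  then have usq: "set_integrable lborel {0..1} (\<lambda>x. (u x)\<^sup>2)"
    unfolding set_integrable_def real_scaleR_def
    by (rule Bochner_Integration.integrable_bound) (auto simp: indicator_def le)
  then show "u \<in> L2"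
    by (simp add: L2_def set_integrable_unit_Icc_Ioo)
  have F: "(LINT x:{0..1}|lborel. (f x)\<^sup>2) = (L2norm f)\<^sup>2"
    by (simp add: L2norm_def set_integral_unit_Icc_Ioo)
      (simp add: set_lebesgue_integral_def integral_nonneg_AE)
  have "(LINT x:{0..1}|lborel. (u x)\<^sup>2) \<le> (LINT x:{0..1}|lborel. 2 * A\<^sup>2 * (f x)\<^sup>2 + 2 * D\<^sup>2)"
    using usq int le by (rule set_integral_mono_unit)
  also have "\<dots> = 2 * (A * L2norm f)\<^sup>2 + 2 * D\<^sup>2"
    using sq by (subst set_integral_add) (auto simp: F power_mult_distrib)
  also have "\<dots> \<le> (2 * (A * L2norm f + D))\<^sup>2"
    using A L2norm_nonneg[of f] by (simp add: power2_sum power_mult_distrib)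
  finally show "L2norm u \<le> 2 * (A * L2norm f + D)"
    unfolding L2norm_def[of u] using A L2norm_nonneg[of f]
    by (intro real_le_lsqrt) (auto simp: set_integral_unit_Icc_Ioo)
qed

section \<open>Solving \<open>a u - K u = f\<close> for an abstract dominated kernel\<close>

text \<open>\<open>dominated\<close> is the abstract form of \<open>A2\<close>. Injectivity is asked
  for continuous functions only, because every fixed point of \<open>S\<close> is
  continuous.\<close>

locale dominated_kernel = continuous_kernel +
  fixes a :: "real \<Rightarrow> real"
  assumes a_continuous: "continuous_on {0..1} a"
    and a_pos: "\<And>x. x \<in> {0..1} \<Longrightarrow> 0 < a x"
    and dominated: "\<And>x. x \<in> {0..1} \<Longrightarrow> (LINT y:{0..1}|lborel. \<bar>k x y\<bar>) \<le> a x"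
    and injective: "\<And>h x. continuous_on {0..1} h \<Longrightarrow> (\<And>x. x \<in> {0..1} \<Longrightarrow> a x * h x = K h x) \<Longrightarrow>
      x \<in> {0..1} \<Longrightarrow> h x = 0"
begin

definition S :: "(real \<Rightarrow>\<^sub>C real) \<Rightarrow> (real \<Rightarrow>\<^sub>C real)" where
  "S h = unit_ext (\<lambda>x. K h x / a x)"

lemma continuous_K_div:
  "set_integrable lborel {0..1} u \<Longrightarrow> continuous_on {0..1} (\<lambda>x. K u x / a x)"
  using continuous_K[of u] a_continuous a_pos by (force intro: continuous_on_divide)

lemma bcontfun_integrable [simp]: "set_integrable lborel {0..1} (apply_bcontfun h)"
  for h :: "real \<Rightarrow>\<^sub>C real"
  by (intro borel_integrable_atLeastAtMost') simp

lemma S_apply: "S h x = K h (clamp 0 1 x) / a (clamp 0 1 x)"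
  unfolding S_def by (intro unit_ext_apply continuous_K_div) simp

lemma K_dominated:
  assumes x: "x \<in> {0..1}" and h: "set_integrable lborel {0..1} h"
    and M: "\<And>y. y \<in> {0..1} \<Longrightarrow> \<bar>h y\<bar> \<le> M"
  shows "\<bar>K h x\<bar> \<le> M * a x"
proof -
  have "\<bar>h 0\<bar> \<le> M" by (intro M) simp
  then have M0: "0 \<le> M" by linarith
  have "\<bar>K h x\<bar> \<le> (LINT y:{0..1}|lborel. \<bar>k x y * h y\<bar>)"
    unfolding K_def using set_integral_norm_bound[OF integrable_k[OF x h]] by simp
  also have "\<dots> \<le> (LINT y:{0..1}|lborel. M * \<bar>k x y\<bar>)"
    using set_integrable_abs[OF integrable_k[OF x h]] set_integrable_abs[OF integrable_kernel[OF x]] M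
    by (intro set_integral_mono_unit) (auto simp: abs_mult mult.commute intro!: mult_right_mono)
  also have "\<dots> \<le> M * a x"
    using dominated[OF x] M0 by (simp add: mult_left_mono)
  finally show ?thesis .
qed

lemma norm_S_le: "norm (S h) \<le> norm h"
proof (rule norm_bound)
  fix x
  have "\<bar>K h (clamp 0 1 x)\<bar> \<le> norm h * a (clamp 0 1 x)"
    using norm_bounded[of h] by (intro K_dominated clamp_unit_mem) auto
  then show "norm (S h x) \<le> norm h"
    using a_pos[OF clamp_unit_mem[of x]] by (simp add: S_apply abs_div pos_divide_le_eq)
qed

lemma bounded_linear_S: "bounded_linear S"
proof (rule bounded_linear_intro)
  show "S (g + h) = S g + S h" for g h
    by (rule bcontfun_eqI) (simp add: S_apply K_add clamp_unit_mem add_divide_distrib)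
  show "S (r *\<^sub>R h) = r *\<^sub>R S h" for r h
    by (rule bcontfun_eqI) (simp add: S_apply K_scale)
  show "norm (S h) \<le> norm h * 1" for h
    using norm_S_le by simp
qed

text \<open>Arzela-Ascoli: the images are bounded by \<open>M\<close> because \<open>S\<close> is
  nonexpansive, and equicontinuous because \<open>K\<close> is so uniformly on bounded sets and
  \<open>a\<close> is continuous and positive.\<close>

lemma S_compact:
  assumes "bounded (range v)"
  shows "\<exists>l r. strict_mono (r :: nat \<Rightarrow> nat) \<and> (\<lambda>n. S (v (r n))) \<longlonglongrightarrow> l"
proof -
  obtain M where M: "\<And>n. norm (v n) \<le> M" "0 < M"
    using assms unfolding bounded_pos by auto
  have vM: "\<bar>v n y\<bar> \<le> M" for n y
    using norm_bounded[of "v n" y] M(1)[of n] by simp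
  have Sle: "\<bar>S (v n) x\<bar> \<le> M" for n x
    using norm_bounded[of "S (v n)" x] norm_S_le[of "v n"] M(1)[of n] by simp
  obtain g r where r: "strict_mono (r :: nat \<Rightarrow> nat)" and g: "continuous_on {0..1} g"
    and lim: "\<And>e. 0 < e \<Longrightarrow> \<exists>N. \<forall>n x. n \<ge> N \<and> x \<in> {0..1} \<longrightarrow> norm (S (v (r n)) x - g x) < e"
  proof (rule Arzela_Ascoli[of "{0..1 :: real}" "\<lambda>n. apply_bcontfun (S (v n))" M])
    fix x e :: real assume x: "x \<in> {0..1}" and e: "0 < e"
    have ax: "0 < a x" using a_pos[OF x] .
    \<comment> \<open>This tolerance serves for \<open>K\<close> and for \<open>a\<close>. Each use
      is multiplied by \<open>M\<close>, so the two errors sum to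
      \<open>2/3 * e * a x\<close>.\<close>
    then have pos: "0 < e * a x / (3 * M)" using e M(2) by simp
    obtain d1 where d1: "0 < d1"
      and Kd: "\<And>n y. y \<in> {0..1} \<Longrightarrow> \<bar>y - x\<bar> < d1 \<Longrightarrow> \<bar>K (v n) x - K (v n) y\<bar> \<le> e * a x / 3"
    proof (rule K_equicontinuous[OF x pos])
      fix d assume d: "0 < d" and *: "\<And>x' h M'. x' \<in> {0..1} \<Longrightarrow> \<bar>x' - x\<bar> < d \<Longrightarrow>
        set_integrable lborel {0..1} h \<Longrightarrow> (\<And>y. y \<in> {0..1} \<Longrightarrow> \<bar>h y\<bar> \<le> M') \<Longrightarrow>
        \<bar>K h x - K h x'\<bar> \<le> M' * (e * a x / (3 * M))"
      show thesis
        using d *[of _ "v _" M] vM M(2) by (intro that) auto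
    qed
    obtain d2 where d2: "0 < d2" and ad: "\<And>x'. x' \<in> {0..1} \<Longrightarrow> \<bar>x' - x\<bar> < d2 \<Longrightarrow> \<bar>a x' - a x\<bar> < e * a x / (3 * M)"
      using a_continuous[unfolded continuous_on_iff dist_real_def, rule_format, OF x pos] by blast
    show "\<exists>d>0. \<forall>n y. y \<in> {0..1} \<and> norm (x - y) < d \<longrightarrow> norm (S (v n) x - S (v n) y) < e"
    proof (intro exI[of _ "min d1 d2"] conjI allI impI)
      fix n y assume "y \<in> {0..1} \<and> norm (x - y) < min d1 d2"
      then have y: "y \<in> {0..1}" and yd: "\<bar>y - x\<bar> < d1" "\<bar>y - x\<bar> < d2" by auto
      have ay: "0 < a y" using a_pos[OF y] .
      have 1: "\<bar>K (v n) x - K (v n) y\<bar> \<le> e * a x / 3"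
        using Kd[OF y yd(1)] .
      have "K (v n) y = S (v n) y * a y" "K (v n) x = S (v n) x * a x"
        using x y ax ay by (simp_all add: S_apply)
      \<comment> \<open>Multiplying by \<open>a x\<close> avoids a difference of quotients: only
        \<open>K\<close> and \<open>a\<close> are compared at two points.\<close>
      then have "(S (v n) x - S (v n) y) * a x = (K (v n) x - K (v n) y) + S (v n) y * (a y - a x)"
        by (simp add: algebra_simps)
      then have "\<bar>S (v n) x - S (v n) y\<bar> * a x = \<bar>(K (v n) x - K (v n) y) + S (v n) y * (a y - a x)\<bar>"
        using ax by (metis abs_mult abs_of_pos)
      also have "\<dots> \<le> e * a x / 3 + M * (e * a x / (3 * M))"
      proof (intro order.trans[OF abs_triangle_ineq] add_mono 1)
        show "\<bar>S (v n) y * (a y - a x)\<bar> \<le> M * (e * a x / (3 * M))"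
          unfolding abs_mult using Sle[of n y] ad[OF y yd(2)] M(2) by (intro mult_mono) auto
      qed
      also have "\<dots> = 2 / 3 * e * a x"
        using M(2) by simp
      also have "\<dots> < e * a x"
        using ax e by (intro mult_strict_right_mono) auto
      finally show "norm (S (v n) x - S (v n) y) < e"
        using ax by simp
    qed (use d1 d2 in simp)
  qed (use Sle in auto)
  have "(\<lambda>n. S (v (r n))) \<longlonglongrightarrow> unit_ext g"
  proof (rule LIMSEQ_I)
    fix e :: real assume e: "0 < e"
    obtain N where N: "\<And>n x. n \<ge> N \<Longrightarrow> x \<in> {0..1} \<Longrightarrow> norm (S (v (r n)) x - g x) < e / 2"
      using lim[of "e / 2"] e by auto
    have "norm (S (v (r n)) - unit_ext g) < e" if n: "n \<ge> N" for n
    proof -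
      have "norm (S (v (r n)) - unit_ext g) \<le> e / 2"
      proof (rule norm_bound)
        fix x
        \<comment> \<open>Functions in the range of \<open>S\<close> are constant on either side of
          the interval, so uniform convergence on \<open>{0..1}\<close> is convergence in
          norm.\<close>
        have "S (v (r n)) x = S (v (r n)) (clamp 0 1 x)"
          using clamp_unit_mem[of x] by (simp add: S_apply)
        then show "norm ((S (v (r n)) - unit_ext g) x) \<le> e / 2"
          using N[OF n clamp_unit_mem[of x]] by (simp add: unit_ext_apply[OF g])
      qed
      then show ?thesis using e by simp
    qed
    then show "\<exists>N. \<forall>n\<ge>N. norm (S (v (r n)) - unit_ext g) < e" by blast
  qed
  then show ?thesis using r by blast
qed

text \<open>A fixed point solves the homogeneous equation on \<open>{0..1}\<close>, where
  \<open>injective\<close> applies; lying in the range of \<open>S\<close>, it is determined by its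
  values there.\<close>

lemma S_injective:
  assumes "S h = h"
  shows "h = 0"
proof -
  have h: "h x = K h (clamp 0 1 x) / a (clamp 0 1 x)" for x
    by (subst assms[symmetric]) (rule S_apply)
  have "a x * h x = K h x" if "x \<in> {0..1}" for x
    using h[of x] that a_pos[OF that] by simp
  then have "h x = 0" if "x \<in> {0..1}" for x
    using that by (intro injective[of h]) auto
  then have "h (clamp 0 1 x) = 0" for x
    using clamp_unit_mem by blast
  moreover have "h x = h (clamp 0 1 x)" for x
    using h[of x] h[of "clamp 0 1 x"] clamp_unit_mem[of x] by simp
  ultimately show ?thesis
    by (intro bcontfun_eqI) simp
qed

lemma S_solvable: "\<exists>c>0. \<forall>g. \<exists>h. h - S h = g \<and> norm h \<le> c * norm g"
  by (rule compact_nonexpansive_solvable[OF bounded_linear_S norm_S_le S_compact S_injective])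

lemma clamp_continuous: "continuous_on UNIV (\<lambda>x. f (clamp 0 1 x))"
  if "continuous_on {0..1 :: real} f" for f :: "real \<Rightarrow> real"
  using continuous_on_apply_bcontfun[of UNIV "unit_ext f"] unit_ext_apply[OF that]
  by (simp cong: continuous_on_cong)

lemma measurable_clamp: "(\<lambda>x. f (clamp 0 1 x)) \<in> borel_measurable lborel"
  if "continuous_on {0..1 :: real} f" for f :: "real \<Rightarrow> real"
  using borel_measurable_continuous_onI[OF clamp_continuous[OF that]] by simp

lemma measurable_bcontfun [measurable]: "apply_bcontfun h \<in> borel_measurable lborel"
  for h :: "real \<Rightarrow>\<^sub>C real"
  using borel_measurable_continuous_onI[OF continuous_on_apply_bcontfun] by simp

lemma measurable_div_a:
  assumes [measurable]: "f \<in> borel_measurable lborel"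
  shows "(\<lambda>x. f x / a (clamp 0 1 x)) \<in> borel_measurable lborel"
proof -
  note [measurable] = measurable_clamp[OF a_continuous]
  show ?thesis by measurable
qed

lemma a_lower: "\<exists>m>0. \<forall>x\<in>{0..1}. m \<le> a x"
proof -
  obtain z where "z \<in> {0..1}" "\<forall>x\<in>{0..1}. a z \<le> a x"
    using continuous_attains_inf[OF _ _ a_continuous] by auto
  then show ?thesis using a_pos by blast
qed

lemma a_upper: "\<exists>m>0. \<forall>x\<in>{0..1}. a x \<le> m"
proof -
  obtain z where "z \<in> {0..1}" "\<forall>x\<in>{0..1}. a x \<le> a z"
    using continuous_attains_sup[OF _ _ a_continuous] by auto
  then show ?thesis using a_pos by blast
qed

text \<open>\<open>L2\<close> demands measurability on the whole line, whereas \<open>a\<close> and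
  \<open>K u\<close> are controlled on \<open>{0..1}\<close> only. Hence the representative is built
  with \<open>clamp\<close>.\<close>

lemma L2_stable:
  assumes u: "u \<in> L2"
  shows "\<exists>g\<in>L2. \<forall>x\<in>{0..1}. a x * u x - K u x = g x"
proof -
  let ?g = "\<lambda>x. a (clamp 0 1 x) * u x - K u (clamp 0 1 x)"
  have [measurable]: "u \<in> borel_measurable lborel"
    using u by (simp add: L2_def)
  note [measurable] = measurable_clamp[OF a_continuous]
    measurable_clamp[OF continuous_K[OF L2_integrable(1)[OF u]]]
  obtain m where m: "0 < m" "\<And>x. x \<in> {0..1} \<Longrightarrow> a x \<le> m" using a_upper by blast
  let ?D = "B * (LINT y:{0..1}|lborel. \<bar>u y\<bar>)"
  have "?g \<in> L2"
  proof (rule L2_bounded_by(1)[OF u, of ?g m ?D])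
    show "0 \<le> ?D"
      using K_bound[of 0 u] L2_integrable(1)[OF u] by force
    show "\<bar>?g x\<bar> \<le> m * \<bar>u x\<bar> + ?D" if x: "x \<in> {0..1}" for x
    proof -
      have "\<bar>?g x\<bar> \<le> \<bar>a x * u x\<bar> + \<bar>K u x\<bar>"
        using x by simp
      moreover have "\<bar>a x * u x\<bar> \<le> m * \<bar>u x\<bar>"
        using a_pos[OF x] m(2)[OF x] by (simp add: abs_mult mult_right_mono)
      ultimately show ?thesis
        using K_bound[OF x L2_integrable(1)[OF u]] by linarith
    qed
  qed (use m in auto)
  then show ?thesis
    by (rule bexI[rotated]) simp
qed

lemma L2_solvable:
  "\<exists>C>0. \<forall>f\<in>L2. \<exists>u\<in>L2. ae_eq (\<lambda>x. a x * u x - K u x) f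
    \<and> (\<forall>v\<in>L2. ae_eq (\<lambda>x. a x * v x - K v x) f \<longrightarrow> ae_eq v u)
    \<and> L2norm u \<le> C * L2norm f"
proof -
  obtain m where m: "0 < m" and ma: "\<And>x. x \<in> {0..1} \<Longrightarrow> m \<le> a x" using a_lower by blast
  obtain c where c: "0 < c" and solve: "\<And>g. \<exists>h. h - S h = g \<and> norm h \<le> c * norm g"
    using S_solvable by blast
  \<comment> \<open>\<open>1 / m\<close> bounds the part \<open>f / a\<close>. The continuous part
    costs \<open>c\<close> for the solution of \<open>h - S h = g\<close>, and
    \<open>g = K (f / a) / a\<close> costs \<open>B\<close> and one \<open>1 / m\<close> for each
    division. The 2 comes from \<open>L2_bounded_by\<close>.\<close>
  define C where "C = 2 * (1 / m + c * (B / m\<^sup>2))"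
  have "\<exists>u\<in>L2. ae_eq (\<lambda>x. a x * u x - K u x) f
    \<and> (\<forall>v\<in>L2. ae_eq (\<lambda>x. a x * v x - K v x) f \<longrightarrow> ae_eq v u)
    \<and> L2norm u \<le> C * L2norm f" if f: "f \<in> L2" for f
  proof -
    define F where "F x = f x / a (clamp 0 1 x)" for x
    have fm: "f \<in> borel_measurable lborel"
      using f by (simp add: L2_def)
    have Fm [measurable]: "F \<in> borel_measurable lborel"
      unfolding F_def using measurable_div_a[OF fm] .
    have Fle: "\<bar>F x\<bar> \<le> 1 / m * \<bar>f x\<bar>" for x
      using ma[OF clamp_unit_mem[of x]] m
      by (auto simp: F_def abs_div intro!: divide_left_mono mult_pos_pos)
    then have FL2: "F \<in> L2"
      using m by (intro L2_bounded_by(1)[OF f Fm, of "1 / m" 0]) auto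
    note Fint = L2_integrable(1)[OF FL2]
    define g where "g = unit_ext (\<lambda>x. K F x / a x)"
    have g_apply: "g x = K F (clamp 0 1 x) / a (clamp 0 1 x)" for x
      unfolding g_def by (intro unit_ext_apply continuous_K_div Fint)
    obtain h where h: "h - S h = g" and h_norm: "norm h \<le> c * norm g"
      using solve by blast
    have normF: "(LINT y:{0..1}|lborel. \<bar>F y\<bar>) \<le> L2norm f / m"
    proof -
      have "(LINT y:{0..1}|lborel. \<bar>F y\<bar>) \<le> (LINT y:{0..1}|lborel. 1 / m * \<bar>f y\<bar>)"
        using set_integrable_abs[OF Fint] set_integrable_abs[OF L2_integrable(1)[OF f]] Fle
        by (intro set_integral_mono_unit) auto
      also have "\<dots> \<le> L2norm f / m"
        using L2_integrable(2)[OF f] m by (simp add: divide_right_mono)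
      finally show ?thesis .
    qed
    have g_norm: "norm g \<le> B / m\<^sup>2 * L2norm f"
    proof (rule norm_bound)
      fix x :: real
      define z :: real where "z = clamp 0 1 x"
      have z: "z \<in> {0..1}" unfolding z_def by (rule clamp_unit_mem)
      have "\<bar>K F z\<bar> \<le> B * (L2norm f / m)"
        using K_bound[OF z Fint] mult_left_mono[OF normF B_nonneg] by linarith
      then have "\<bar>K F z\<bar> / a z \<le> B * (L2norm f / m) / m"
        using ma[OF z] m B_nonneg L2norm_nonneg[of f] by (intro frac_le) auto
      then show "norm (g x) \<le> B / m\<^sup>2 * L2norm f"
        using a_pos[OF z] by (simp add: g_apply abs_div power2_eq_square flip: z_def)
    qed
    define u where "u x = F x + h x" for x
    have um: "u \<in> borel_measurable lborel"
      unfolding u_def by measurable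
    have ule: "\<bar>u x\<bar> \<le> 1 / m * \<bar>f x\<bar> + norm h" for x
      using Fle[of x] norm_bounded[of h x] unfolding u_def by (simp add: abs_le_iff)
    have uL2: "u \<in> L2"
      using m ule by (intro L2_bounded_by(1)[OF f um, of "1 / m" "norm h"]) auto
    have "L2norm u \<le> 2 * (1 / m * L2norm f + norm h)"
      using m ule by (intro L2_bounded_by(2)[OF f um, of "1 / m" "norm h"]) auto
    also have "\<dots> \<le> 2 * (1 / m * L2norm f + c * (B / m\<^sup>2 * L2norm f))"
      using h_norm mult_left_mono[OF g_norm, of c] c by simp
    also have "\<dots> = C * L2norm f"
      unfolding C_def by (simp add: algebra_simps)
    finally have norm_u: "L2norm u \<le> C * L2norm f" .
    have Ku: "K (\<lambda>y. F y + h y) x = K F x + K h x" if "x \<in> {0..1}" for x and h :: "real \<Rightarrow>\<^sub>C real"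
      using that by (intro K_add Fint) auto
    have "a x * u x - K u x = f x" if x: "x \<in> {0..1}" for x
    proof -
      have "h x = S h x + g x"
        using h by (metis diff_add_cancel plus_bcontfun.rep_eq add.commute)
      then have "a x * h x = K h x + K F x"
        using x a_pos[OF x] by (simp add: S_apply g_apply field_simps)
      moreover have "a x * F x = f x"
        using x a_pos[OF x] by (simp add: F_def)
      moreover have "K u x = K F x + K h x"
        unfolding u_def using Ku[OF x] .
      ultimately show ?thesis
        by (simp add: u_def distrib_left)
    qed
    then have sol: "ae_eq (\<lambda>x. a x * u x - K u x) f"
      by (auto simp: ae_eq_def)
    have "ae_eq v u" if v: "v \<in> L2" and eq: "ae_eq (\<lambda>x. a x * v x - K v x) f" for v
    proof -
      have vm: "v \<in> borel_measurable lborel"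
        using v by (simp add: L2_def)
      \<comment> \<open>Any solution \<open>v\<close> splits as \<open>F + h'\<close> almost
        everywhere. Since \<open>K\<close> does not see null sets, \<open>h'\<close> satisfies the
        same equation \<open>h' = S h' + g\<close> as \<open>h\<close> at every point, and
        \<open>S_injective\<close> identifies the two.\<close>
      define h' where "h' = unit_ext (\<lambda>x. K v x / a x)"
      have h'_apply: "h' x = K v (clamp 0 1 x) / a (clamp 0 1 x)" for x
        unfolding h'_def by (intro unit_ext_apply continuous_K_div L2_integrable(1) v)
      have v_eq: "ae_eq v (\<lambda>x. F x + h' x)"
        using eq unfolding ae_eq_def
      proof eventually_elim
        case (elim x)
        show ?case
        proof
          assume x: "x \<in> {0<..<1}"
          then have "a x * v x = f x + K v x" "0 < a x" "x \<in> {0..1}"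
            using elim a_pos by (auto simp: algebra_simps)
          then show "v x = F x + h' x"
            by (simp add: F_def h'_apply field_simps)
        qed
      qed
      have Kv: "K v x = K F x + K h' x" if "x \<in> {0..1}" for x
        using K_cong_AE[OF that vm _ v_eq] Ku[OF that] by simp
      have "h' x = S h' x + g x" for x
        using clamp_unit_mem[of x] by (simp add: h'_apply S_apply g_apply Kv add_divide_distrib)
      then have "h' = S h' + g"
        by (intro bcontfun_eqI) simp
      moreover have "h = S h + g"
        using h by (simp add: algebra_simps)
      ultimately have "S (h' - h) = h' - h"
        using bounded_linear.linear[OF bounded_linear_S, THEN linear_diff] by (metis add_diff_cancel_right)
      then have "h' = h"
        using S_injective by fastforce
      then show ?thesis
        using v_eq unfolding u_def[abs_def] by simp
    qed
    then show ?thesis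
      using uL2 sol norm_u by blast
  qed
  moreover have "0 < C"
    unfolding C_def using m c B_nonneg by (intro mult_pos_pos add_pos_nonneg) auto
  ultimately show ?thesis by blast
qed

end

section \<open>The nonlocal Dirichlet kernel\<close>

lemma AE_lborel_meets_interval:
  fixes a b :: real
  assumes "AE x in lborel. P x" and "a < b"
  shows "\<exists>x\<in>{a<..<b}. P x"
proof (rule ccontr)
  assume "\<not> ?thesis"
  with assms(1) have "AE x in lborel. x \<notin> {a<..<b}"
    by (auto elim!: eventually_mono)
  then have "emeasure lborel {a<..<b} = 0"
    by (subst AE_iff_measurable[symmetric, where P = "\<lambda>x. x \<notin> {a<..<b}"]) auto
  with \<open>a < b\<close> show False by simp
qed

lemma set_integral_pos:
  fixes f :: "real \<Rightarrow> real"
  assumes int: "set_integrable lborel A f" and nonneg: "\<And>x. x \<in> A \<Longrightarrow> 0 \<le> f x"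
    and pos: "\<And>x. x \<in> {a<..<b} \<Longrightarrow> x \<in> A \<and> 0 < f x" and "a < b"
  shows "0 < (LINT x:A|lborel. f x)"
proof -
  let ?f = "\<lambda>x. indicator A x * f x"
  have nn: "AE x in lborel. 0 \<le> ?f x"
    using nonneg by (auto simp: indicator_def)
  have "(LINT x|lborel. ?f x) \<noteq> 0"
  proof
    assume "(LINT x|lborel. ?f x) = 0"
    then have "AE x in lborel. ?f x = 0"
      using int nn integral_nonneg_eq_0_iff_AE[of lborel ?f] by (simp add: set_integrable_def)
    then show False
      using AE_lborel_meets_interval[OF _ \<open>a < b\<close>] pos by fastforce
  qed
  moreover have "0 \<le> (LINT x|lborel. ?f x)"
    using nn by (rule integral_nonneg_AE)
  ultimately show ?thesis
    by (simp add: set_lebesgue_integral_def)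
qed

text \<open>For a limit point \<open>x\<close>, convergence can fail only at the finitely many
  \<open>y\<close> with \<open>x - y\<close> in \<open>F\<close>, which form a null set.\<close>

lemma continuous_kernel_convolution:
  fixes \<psi> :: "real \<Rightarrow> real"
  assumes "\<psi> \<in> borel_measurable lborel" and "\<And>z. \<bar>\<psi> z\<bar> \<le> B"
    and "finite F" and cont: "\<And>z. z \<notin> F \<Longrightarrow> isCont \<psi> z"
  shows "continuous_kernel (\<lambda>x y. \<psi> (x - y)) B"
proof
  have [measurable]: "\<psi> \<in> borel_measurable borel" using assms(1) by simp
  show "(\<lambda>y. \<psi> (x - y)) \<in> borel_measurable lborel" for x by measurable
  show "AE y in lborel. (\<lambda>n. \<psi> (X n - y)) \<longlonglongrightarrow> \<psi> (x - y)" if "X \<longlonglongrightarrow> x" for X x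
  proof -
    have "finite ((\<lambda>z. x - z) ` F)" using \<open>finite F\<close> by simp
    then have "AE y in lborel. y \<notin> (\<lambda>z. x - z) ` F"
      by (intro AE_not_in finite_imp_null_set_lborel)
    then show ?thesis
    proof eventually_elim
      case (elim y)
      then have "x - y \<notin> F" by force
      then show ?case
        using that by (intro isCont_tendsto_compose[OF cont] tendsto_intros)
    qed
  qed
qed (use assms(2) in auto)

section \<open>The Dirichlet kernel in convolution form\<close>

text \<open>Here \<phi> stands for the rescaled kernel
  \<open>w (|z| / \<delta>) / \<delta> ^ 3\<close>. Monotonicity in \<open>|z|\<close> over the
  whole line also encodes that \<phi> is even and bounded by \<open>\<phi> 0\<close>.\<close>

locale nonlocal_problem =
  fixes \<phi> :: "real \<Rightarrow> real" and \<delta> :: real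
  assumes delta: "0 < \<delta>" "\<delta> < 1/2"
    and phi_continuous: "continuous_on {-\<delta><..<\<delta>} \<phi>"
    and phi_pos: "\<And>z. \<bar>z\<bar> < \<delta> \<Longrightarrow> 0 < \<phi> z"
    and phi_zero: "\<And>z. \<delta> \<le> \<bar>z\<bar> \<Longrightarrow> \<phi> z = 0"
    and phi_mono: "\<And>y z. \<bar>y\<bar> \<le> \<bar>z\<bar> \<Longrightarrow> \<phi> z \<le> \<phi> y"
begin

definition near :: "real \<Rightarrow> real" where "near z = indicator {0..\<delta>} \<bar>z\<bar>"

text \<open>The integral in \<open>bd\<close> over the part of the horizon beyond the boundary,
  written in the distance variable \<open>z\<close>, for a point at distance \<open>x\<close> from
  the boundary.\<close>

definition moment :: "real \<Rightarrow> real" where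
  "moment x = (LINT z:{x..\<delta>}|lborel. z * \<phi> z)"

text \<open>The coefficient \<open>bd\<close> as a function of the distance to the nearer end point,
  the same for both boundary layers.\<close>

definition edge :: "real \<Rightarrow> real" where
  "edge x = 2 / (x + \<delta>)\<^sup>2 * moment x"

text \<open>Since \<open>\<delta> < 1/2\<close>, the two boundary layers are disjoint and at most one summand is nonzero. Unlike
  \<open>bd\<close>, this function is continuous up to the end points of the interval.\<close>
definition \<beta> :: "real \<Rightarrow> real" where "\<beta> x = edge x + edge (1 - x)"

definition \<kappa> :: "real \<Rightarrow> real \<Rightarrow> real" where
  "\<kappa> x y = \<phi> (x - y) - \<beta> x * near (x - y)"

definition \<alpha> :: "real \<Rightarrow> real" where "\<alpha> x = (LINT y:{0..1}|lborel. \<phi> (x - y))"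

lemma phi_nonneg: "0 \<le> \<phi> z"
  using phi_pos[of z] phi_zero[of z] by linarith

lemma phi_le: "\<phi> z \<le> \<phi> 0"
  by (rule phi_mono) simp

lemma phi_minus: "\<phi> (- z) = \<phi> z"
  by (intro antisym phi_mono) auto

lemma phi_measurable [measurable]: "\<phi> \<in> borel_measurable borel"
proof -
  have "\<phi> = (\<lambda>z. indicator {-\<delta><..<\<delta>} z *\<^sub>R \<phi> z)"
  proof
    show "\<phi> z = indicator {-\<delta><..<\<delta>} z *\<^sub>R \<phi> z" for z
      using phi_zero[of z] by (cases "\<bar>z\<bar> < \<delta>") (auto simp: indicator_def abs_less_iff)
  qed
  then show ?thesis
    using borel_measurable_continuous_on_indicator[OF _ phi_continuous] by simp
qed

lemma near_measurable [measurable]: "near \<in> borel_measurable borel"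
  unfolding near_def[abs_def] by measurable

lemma near_bounds: "0 \<le> near z" "near z \<le> 1"
  by (auto simp: near_def indicator_def)

lemma open_outside: "open {z :: real. \<delta> < \<bar>z\<bar>}"
  by (intro open_Collect_less continuous_intros)

lemma isCont_phi: assumes "\<bar>z\<bar> \<noteq> \<delta>" shows "isCont \<phi> z"
proof (cases "\<bar>z\<bar> < \<delta>")
  case True
  then show ?thesis
    using continuous_on_interior[OF phi_continuous, of z] by (simp add: abs_less_iff)
next
  case False
  have "continuous_on {z. \<delta> < \<bar>z\<bar>} \<phi>"
    by (rule continuous_on_eq[of _ "\<lambda>_. 0"]) (auto simp: phi_zero)
  then show ?thesis
    using False assms open_outside by (auto simp: continuous_on_eq_continuous_at)
qed

lemma isCont_near: assumes "\<bar>z\<bar> \<noteq> \<delta>" shows "isCont near z"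
proof (cases "\<bar>z\<bar> < \<delta>")
  case True
  have "continuous_on {-\<delta><..<\<delta>} near"
    by (rule continuous_on_eq[of _ "\<lambda>_. 1"]) (auto simp: near_def)
  then show ?thesis
    using True by (auto simp: continuous_on_eq_continuous_at abs_less_iff)
next
  case False
  have "continuous_on {z. \<delta> < \<bar>z\<bar>} near"
    by (rule continuous_on_eq[of _ "\<lambda>_. 0"]) (auto simp: near_def)
  then show ?thesis
    using False assms open_outside by (auto simp: continuous_on_eq_continuous_at)
qed

sublocale phi: continuous_kernel "\<lambda>x y. \<phi> (x - y)" "\<phi> 0"
  using phi_nonneg phi_le isCont_phi
  by (intro continuous_kernel_convolution[where F = "{\<delta>, -\<delta>}"]) auto

sublocale near: continuous_kernel "\<lambda>x y. near (x - y)" 1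
  using near_bounds isCont_near
  by (intro continuous_kernel_convolution[where F = "{\<delta>, -\<delta>}"]) auto

lemma alpha_eq: "\<alpha> = phi.K (\<lambda>_. 1)"
  by (simp add: \<alpha>_def phi.K_def fun_eq_iff)

lemma alpha_continuous: "continuous_on {0..1} \<alpha>"
  unfolding alpha_eq by (intro phi.continuous_K) simp

lemma alpha_pos:
  assumes x: "x \<in> {0..1}"
  shows "0 < \<alpha> x"
  unfolding \<alpha>_def
proof (rule set_integral_pos)
  show "set_integrable lborel {0..1} (\<lambda>y. \<phi> (x - y))"
    using phi.integrable_kernel[OF x] .
  show "max 0 (x - \<delta>) < min 1 (x + \<delta>)"
    using x delta by auto
  show "y \<in> {0..1} \<and> 0 < \<phi> (x - y)" if "y \<in> {max 0 (x - \<delta>)<..<min 1 (x + \<delta>)}" for y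
    using that by (auto intro!: phi_pos)
qed (rule phi_nonneg)

lemma moment_integrable:
  assumes "0 \<le> x"
  shows "set_integrable lborel {x..\<delta>} (\<lambda>z. z * \<phi> z)"
proof -
  have "integrable lborel (\<lambda>z. indicator {x..\<delta>} z *\<^sub>R (\<delta> * \<phi> 0))"
    by (rule borel_integrable_atLeastAtMost'[unfolded set_integrable_def]) simp
  then show ?thesis
    unfolding set_integrable_def
  proof (rule Bochner_Integration.integrable_bound)
    show "AE z in lborel. norm (indicator {x..\<delta>} z *\<^sub>R (z * \<phi> z)) \<le> norm (indicator {x..\<delta>} z *\<^sub>R (\<delta> * \<phi> 0))"
      using assms phi_le phi_nonneg delta by (auto simp: indicator_def abs_mult intro!: mult_mono)
  qed measurable
qed

lemma moment_eq_0: "\<delta> \<le> x \<Longrightarrow> moment x = 0"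
  unfolding moment_def set_lebesgue_integral_def
  by (rule integral_eq_zero_AE) (auto simp: indicator_def phi_zero)

lemma moment_pos: assumes "0 \<le> x" "x < \<delta>" shows "0 < moment x"
  unfolding moment_def using assms
  by (intro set_integral_pos[of _ _ x \<delta>] moment_integrable)
    (auto intro!: mult_nonneg_nonneg mult_pos_pos phi_nonneg phi_pos)

lemma moment_le:
  assumes "0 \<le> x" "x \<le> \<delta>"
  shows "moment x \<le> \<phi> x * ((\<delta>\<^sup>2 - x\<^sup>2) / 2)"
proof -
  have "moment x \<le> (LINT z:{x..\<delta>}|lborel. \<phi> x * z)"
    unfolding moment_def using assms
    by (intro set_integral_mono moment_integrable borel_integrable_atLeastAtMost' continuous_intros)
      (auto simp: mult.commute[of "\<phi> x"] intro!: mult_left_mono phi_mono)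
  also have "(LINT z:{x..\<delta>}|lborel. z) = \<delta>\<^sup>2 / 2 - x\<^sup>2 / 2"
    unfolding set_lebesgue_integral_def using assms
    by (intro integral_FTC_atLeastAtMost)
      (auto intro!: derivative_eq_intros continuous_intros simp flip: has_real_derivative_iff_has_vector_derivative)
  then have "(LINT z:{x..\<delta>}|lborel. \<phi> x * z) = \<phi> x * ((\<delta>\<^sup>2 - x\<^sup>2) / 2)"
    by (simp add: diff_divide_distrib)
  finally show ?thesis .
qed

text \<open>The moving lower limit is read as the kernel \<open>indicator {x..\<delta>} y\<close>,
  whose only jump in \<open>x\<close> is at \<open>x = y\<close>, so that
  \<open>continuous_K\<close> applies.\<close>

lemma moment_continuous: "continuous_on {0..1} moment"
proof -
  interpret continuous_kernel "\<lambda>x y. indicator {x..\<delta>} y" 1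
  proof
    show "AE y in lborel. (\<lambda>n. indicator {X n..\<delta>} y) \<longlonglongrightarrow> (indicator {x..\<delta>} y :: real)"
      if "X \<longlonglongrightarrow> x" for X x
      using AE_lborel_singleton[of x]
    proof eventually_elim
      case (elim y)
      then consider "x < y" | "y < x" by linarith
      then have "eventually (\<lambda>n. indicator {X n..\<delta>} y = (indicator {x..\<delta>} y :: real)) sequentially"
      proof cases
        case 1
        from order_tendstoD(2)[OF that 1] show ?thesis
          by eventually_elim (use 1 in \<open>auto simp: indicator_def\<close>)
      next
        case 2
        from order_tendstoD(1)[OF that 2] show ?thesis
          by eventually_elim (use 2 in \<open>auto simp: indicator_def\<close>)
      qed
      then show ?case by (rule tendsto_eventually)
    qed
  qed (auto simp: indicator_def)
  have "set_integrable lborel {0..1} (\<lambda>z. indicator {0..\<delta>} z * (z * \<phi> z))"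
  proof -
    have "(\<lambda>z. indicator {0..1} z *\<^sub>R (indicator {0..\<delta>} z * (z * \<phi> z))) =
        (\<lambda>z. indicator {0..\<delta>} z *\<^sub>R (z * \<phi> z))"
      using delta by (auto simp: indicator_def fun_eq_iff)
    then show ?thesis
      using moment_integrable[of 0] by (simp add: set_integrable_def)
  qed
  from continuous_K[OF this] show ?thesis
  proof (rule continuous_on_eq)
    show "K (\<lambda>z. indicator {0..\<delta>} z * (z * \<phi> z)) x = moment x" if "x \<in> {0..1}" for x
      unfolding K_def moment_def set_lebesgue_integral_def
      using that delta by (intro Bochner_Integration.integral_cong) (auto simp: indicator_def)
  qed
qed

lemma edge_eq_0: "\<delta> \<le> x \<Longrightarrow> edge x = 0"
  by (simp add: edge_def moment_eq_0)

lemma edge_pos: "0 \<le> x \<Longrightarrow> x < \<delta> \<Longrightarrow> 0 < edge x"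
  unfolding edge_def using delta by (intro mult_pos_pos divide_pos_pos moment_pos) auto

lemma edge_nonneg: "0 \<le> x \<Longrightarrow> 0 \<le> edge x"
  using edge_pos[of x] edge_eq_0[of x] by linarith

text \<open>On \<open>{x..\<delta>}\<close> the kernel is at most \<open>\<phi> x\<close>, which
  leads to \<open>edge x \<le> \<phi> x * ((\<delta> - x) / (\<delta> + x))\<close>. The last factor
  is below 1 because \<open>0 < x\<close>; at the boundary itself strictness would be lost.\<close>

lemma edge_less_phi:
  assumes "0 < x" "x < \<delta>"
  shows "edge x < \<phi> x"
proof -
  have "edge x \<le> 2 / (x + \<delta>)\<^sup>2 * (\<phi> x * ((\<delta>\<^sup>2 - x\<^sup>2) / 2))"
    unfolding edge_def using assms by (intro mult_left_mono moment_le) auto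
  also have "\<dots> = \<phi> x * ((\<delta> - x) / (\<delta> + x))"
  proof -
    have "\<delta>\<^sup>2 - x\<^sup>2 = (\<delta> + x) * (\<delta> - x)" by (simp add: power2_eq_square algebra_simps)
    moreover have "\<delta> + x \<noteq> 0" using assms by simp
    ultimately show ?thesis
      by (simp only: power2_eq_square add.commute[of x]) (simp add: divide_simps)
  qed
  also have "\<dots> < \<phi> x * 1"
    using assms phi_pos[of x] by (intro mult_strict_left_mono) auto
  finally show ?thesis by simp
qed

lemma edge_continuous: "continuous_on {0..1} edge"
  unfolding edge_def[abs_def] using delta
  by (intro continuous_intros moment_continuous) auto

lemma beta_continuous: "continuous_on {0..1} \<beta>"
  unfolding \<beta>_def[abs_def]
  by (intro continuous_intros edge_continuous continuous_on_compose2[OF edge_continuous]) auto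

lemma beta_nonneg: "x \<in> {0..1} \<Longrightarrow> 0 \<le> \<beta> x"
  by (simp add: \<beta>_def edge_nonneg)

lemma beta_bounded: "\<exists>b. \<forall>x\<in>{0..1}. \<beta> x \<le> b"
proof -
  obtain z where "z \<in> {0..1}" "\<forall>x\<in>{0..1}. \<beta> x \<le> \<beta> z"
    using continuous_attains_sup[OF _ _ beta_continuous] by auto
  then show ?thesis by blast
qed

lemma continuous_kernel_kappa: "\<exists>B. continuous_kernel \<kappa> B"
proof -
  obtain b where b: "\<And>x. x \<in> {0..1} \<Longrightarrow> \<beta> x \<le> b"
    using beta_bounded by blast
  have "continuous_kernel \<kappa> (\<phi> 0 + b)"
  proof
    show "\<kappa> x \<in> borel_measurable lborel" for x
      unfolding \<kappa>_def[abs_def] by measurable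
    show "\<bar>\<kappa> x y\<bar> \<le> \<phi> 0 + b" if x: "x \<in> {0..1}" for x y
    proof -
      have "\<beta> x * near (x - y) \<le> \<beta> x" "0 \<le> \<beta> x * near (x - y)"
        using beta_nonneg[OF x] near_bounds[of "x - y"] by (auto intro: mult_left_le)
      then show ?thesis
        using b[OF x] beta_nonneg[OF x] phi_le[of "x - y"] phi_nonneg[of "x - y"]
        unfolding \<kappa>_def by linarith
    qed
    show "AE y in lborel. (\<lambda>n. \<kappa> (X n) y) \<longlonglongrightarrow> \<kappa> x y"
      if X: "\<And>n. X n \<in> {0..1}" "x \<in> {0..1}" "X \<longlonglongrightarrow> x" for X x
    proof -
      have beta: "(\<lambda>n. \<beta> (X n)) \<longlonglongrightarrow> \<beta> x"
        using beta_continuous X by (auto simp: continuous_on_sequentially o_def)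
      show ?thesis
        using phi.k_tendsto[OF X] near.k_tendsto[OF X] unfolding \<kappa>_def
        by eventually_elim (intro tendsto_intros beta)
    qed
  qed
  then show ?thesis by blast
qed

lemma kappa_pos_near_diagonal:
  assumes "0 < x" "x < 1"
  shows "\<exists>e>0. \<forall>y. \<bar>y - x\<bar> < e \<longrightarrow> 0 < \<kappa> x y"
proof -
  have *: "0 < \<kappa> x y" if "\<beta> x < \<phi> (x - y)" for y
    using that near_bounds[of "x - y"] beta_nonneg[of x] mult_left_mono[of "near (x - y)" 1 "\<beta> x"] assms
    by (simp add: \<kappa>_def)
  consider "x < \<delta>" | "1 - x < \<delta>" | "\<delta> \<le> x" "\<delta> \<le> 1 - x" by linarith
  then show ?thesis
  proof cases
    case 1
    then have "\<beta> x < \<phi> x"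
      using assms delta edge_less_phi[of x] by (simp add: \<beta>_def edge_eq_0)
    \<comment> \<open>The radius is the distance to the boundary: within it monotonicity gives
      \<open>\<phi> x \<le> \<phi> (x - y)\<close>, and \<open>\<phi> x\<close> already exceeds
      \<open>\<beta> x\<close>.\<close>
    then have "0 < \<kappa> x y" if "\<bar>y - x\<bar> < x" for y
      using that phi_mono[of "x - y" x] \<open>\<beta> x < \<phi> x\<close> by (intro *) linarith
    then show ?thesis using assms by blast
  next
    case 2
    then have "\<beta> x < \<phi> (1 - x)"
      using assms delta edge_less_phi[of "1 - x"] by (simp add: \<beta>_def edge_eq_0)
    then have "0 < \<kappa> x y" if "\<bar>y - x\<bar> < 1 - x" for y
      using that phi_mono[of "x - y" "1 - x"] \<open>\<beta> x < \<phi> (1 - x)\<close> by (intro *) linarith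
    then show ?thesis using assms by (intro exI[of _ "1 - x"]) auto
  next
    case 3
    then have "\<beta> x = 0" by (simp add: \<beta>_def edge_eq_0)
    then have "0 < \<kappa> x y" if "\<bar>y - x\<bar> < \<delta>" for y
      using that phi_pos[of "x - y"] by (intro *) (auto simp: abs_minus_commute)
    then show ?thesis using delta by blast
  qed
qed

end

section \<open>Strong maximum principle under the domination hypothesis\<close>

locale dominated_nonlocal_problem = nonlocal_problem +
  assumes kappa_dominated: "\<And>x. x \<in> {0<..<1} \<Longrightarrow> (LINT y:{0..1}|lborel. \<bar>\<kappa> x y\<bar>) \<le> \<alpha> x"
begin

definition bound :: real where "bound = (SOME B. continuous_kernel \<kappa> B)"

sublocale kappa: continuous_kernel \<kappa> bound
  unfolding bound_def using continuous_kernel_kappa by (rule someI_ex)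

text \<open>Both sides are continuous up to the end points, so the inequality passes to the closure.
  This is needed because a maximum may sit at an end point.\<close>

lemma kappa_dominated_closed:
  assumes "x \<in> {0..1}"
  shows "(LINT y:{0..1}|lborel. \<bar>\<kappa> x y\<bar>) \<le> \<alpha> x"
proof -
  interpret abs: continuous_kernel "\<lambda>x y. \<bar>\<kappa> x y\<bar>" bound
    by (rule kappa.continuous_kernel_abs)
  let ?f = "\<lambda>x. \<alpha> x - (LINT y:{0..1}|lborel. \<bar>\<kappa> x y\<bar>)"
  have cl: "closure {0<..<1 :: real} = {0..1}"
    by (simp add: closure_greaterThanLessThan)
  have "continuous_on {0..1} ?f"
    using abs.continuous_K[of "\<lambda>_. 1"] alpha_continuous
    by (intro continuous_on_diff) (simp_all add: abs.K_def[abs_def])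
  then have cont: "continuous_on (closure {0<..<1}) ?f"
    by (simp only: cl)
  have "0 \<le> ?f x"
  proof (rule continuous_ge_on_closure[OF cont])
    show "x \<in> closure {0<..<1}" using assms by (simp only: cl)
    show "0 \<le> ?f z" if "z \<in> {0<..<1}" for z
      using kappa_dominated[OF that] by simp
  qed
  then show ?thesis by simp
qed

text \<open>Equality case of the domination: the gap \<open>?p\<close> is nonnegative by maximality,
  while the equation and \<open>kappa_dominated_closed\<close> make its integral nonpositive. Hence
  it vanishes almost everywhere.\<close>

lemma AE_sign_at_maximum:
  assumes h: "continuous_on {0..1} h" and eq: "\<alpha> x * h x = kappa.K h x"
    and x: "x \<in> {0..1}" and max: "\<And>y. y \<in> {0..1} \<Longrightarrow> \<bar>h y\<bar> \<le> \<bar>h x\<bar>"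
  shows "AE y in lborel. y \<in> {0<..<1} \<longrightarrow> sgn (h x) * (\<kappa> x y * h y) = \<bar>h x\<bar> * \<bar>\<kappa> x y\<bar>"
proof -
  let ?p = "\<lambda>y. \<bar>h x\<bar> * \<bar>\<kappa> x y\<bar> - sgn (h x) * (\<kappa> x y * h y)"
  have int1: "set_integrable lborel {0..1} (\<lambda>y. \<bar>h x\<bar> * \<bar>\<kappa> x y\<bar>)"
    using set_integrable_abs[OF kappa.integrable_kernel[OF x]] by simp
  have int2: "set_integrable lborel {0..1} (\<lambda>y. sgn (h x) * (\<kappa> x y * h y))"
    using kappa.integrable_k[OF x borel_integrable_atLeastAtMost'[OF h]] by simp
  have nn: "0 \<le> ?p y" if "y \<in> {0..1}" for y
  proof -
    have "sgn (h x) * (\<kappa> x y * h y) \<le> \<bar>sgn (h x) * (\<kappa> x y * h y)\<bar>" by (rule abs_ge_self)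
    also have "\<dots> \<le> 1 * (\<bar>\<kappa> x y\<bar> * \<bar>h x\<bar>)"
      unfolding abs_mult using max[OF that] by (intro mult_mono) (auto simp: abs_sgn_eq)
    finally show ?thesis by (simp add: mult.commute)
  qed
  have "(LINT y:{0..1}|lborel. ?p y) = \<bar>h x\<bar> * (LINT y:{0..1}|lborel. \<bar>\<kappa> x y\<bar>) - sgn (h x) * kappa.K h x"
    using set_integral_diff(2)[OF int1 int2] by (simp add: kappa.K_def)
  also have "sgn (h x) * kappa.K h x = \<bar>h x\<bar> * \<alpha> x"
    by (simp add: abs_sgn mult_ac flip: eq)
  also have "\<bar>h x\<bar> * (LINT y:{0..1}|lborel. \<bar>\<kappa> x y\<bar>) - \<bar>h x\<bar> * \<alpha> x \<le> 0"
    using kappa_dominated_closed[OF x] by (simp add: mult_left_mono)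
  finally have le0: "(LINT y|lborel. indicator {0..1} y * ?p y) \<le> 0"
    by (simp add: set_lebesgue_integral_def)
  have nn': "AE y in lborel. 0 \<le> indicator {0..1} y * ?p y"
    using nn by (auto simp: indicator_def)
  have "(LINT y|lborel. indicator {0..1} y * ?p y) = 0"
    using le0 integral_nonneg_AE[OF nn'] by simp
  moreover have "integrable lborel (\<lambda>y. indicator {0..1} y * ?p y)"
    using set_integral_diff(1)[OF int1 int2] by (simp add: set_integrable_def)
  ultimately have "AE y in lborel. indicator {0..1} y * ?p y = 0"
    using integral_nonneg_eq_0_iff_AE[OF _ nn'] by blast
  then show ?thesis
    by eventually_elim (auto simp: indicator_def)
qed

lemma locally_constant_at_maximum:
  assumes h: "continuous_on {0..1} h" and eq: "\<alpha> x * h x = kappa.K h x"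
    and x: "x \<in> {0<..<1}" and max: "\<And>y. y \<in> {0..1} \<Longrightarrow> \<bar>h y\<bar> \<le> \<bar>h x\<bar>" and nz: "h x \<noteq> 0"
  shows "\<exists>e>0. \<forall>y. \<bar>y - x\<bar> < e \<longrightarrow> h y = h x"
proof -
  obtain e1 where e1: "0 < e1" and pos: "\<And>y. \<bar>y - x\<bar> < e1 \<Longrightarrow> 0 < \<kappa> x y"
    using kappa_pos_near_diagonal[of x] x by auto
  \<comment> \<open>The ball stays where \<kappa> is positive and inside the open interval, where
    the sign identity is available.\<close>
  define e where "e = min e1 (min x (1 - x))"
  have e: "0 < e" using e1 x by (simp add: e_def)
  have ball: "y \<in> {0<..<1}" if "\<bar>y - x\<bar> < e" for y
    using that by (auto simp: e_def)
  have "AE y in lborel. y \<in> {0<..<1} \<longrightarrow> sgn (h x) * (\<kappa> x y * h y) = \<bar>h x\<bar> * \<bar>\<kappa> x y\<bar>"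
    using x by (intro AE_sign_at_maximum h eq max) auto
  then have ae: "AE y in lborel. \<bar>y - x\<bar> < e \<longrightarrow> h y = h x"
  proof eventually_elim
    case (elim y)
    show ?case
    proof
      assume y: "\<bar>y - x\<bar> < e"
      then have "0 < \<kappa> x y" using pos by (simp add: e_def)
      moreover have "sgn (h x) * (\<kappa> x y * h y) = \<bar>h x\<bar> * \<bar>\<kappa> x y\<bar>"
        using elim ball[OF y] by simp
      ultimately show "h y = h x"
        using nz by (cases "h x > 0") (auto simp: sgn_if abs_if split: if_splits)
    qed
  qed
  have "h y = h x" if y: "\<bar>y - x\<bar> < e" for y
  proof (rule ccontr)
    assume neq: "h y \<noteq> h x"
    have "isCont h y"
      using continuous_on_interior[OF h, of y] ball[OF y] by simp
    then obtain d where d: "0 < d" and far: "\<And>z. \<bar>z - y\<bar> < d \<Longrightarrow> h z \<noteq> h x"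
      using continuous_at_avoid[of y h "h x"] neq by (auto simp: dist_real_def abs_minus_commute)
    \<comment> \<open>The interval of radius \<open>r\<close> about \<open>y\<close> lies both where
      \<open>h\<close> avoids \<open>h x\<close> and where \<open>h = h x\<close> almost everywhere,
      which is contradictory.\<close>
    define r where "r = min d (e - \<bar>y - x\<bar>)"
    have "0 < r" using d y by (simp add: r_def)
    then obtain z where "z \<in> {y - r<..<y + r}" "\<bar>z - x\<bar> < e \<longrightarrow> h z = h x"
      using AE_lborel_meets_interval[OF ae, of "y - r" "y + r"] by auto
    moreover from this have "\<bar>z - y\<bar> < r" by auto
    then have "\<bar>z - y\<bar> < d" "\<bar>z - x\<bar> < e"
      unfolding r_def by linarith+
    ultimately show False
      using far[of z] by simp
  qed
  then show ?thesis using e by blast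
qed

lemma strong_maximum_principle:
  assumes h: "continuous_on {0..1} h" and eq: "\<And>x. x \<in> {0..1} \<Longrightarrow> \<alpha> x * h x = kappa.K h x"
    and x: "x \<in> {0..1}"
  shows "h x = 0"
proof (rule ccontr)
  assume "h x \<noteq> 0"
  have "continuous_on {0..1} (\<lambda>x. \<bar>h x\<bar>)"
    using h by (intro continuous_intros)
  then obtain x0 where x0: "x0 \<in> {0..1}" and max: "\<And>y. y \<in> {0..1} \<Longrightarrow> \<bar>h y\<bar> \<le> \<bar>h x0\<bar>"
    using continuous_attains_sup[of "{0..1 :: real}" "\<lambda>x. \<bar>h x\<bar>"] by auto
  have nz: "h x0 \<noteq> 0"
    using max[OF x] \<open>h x \<noteq> 0\<close> by auto
  \<comment> \<open>Positivity near the diagonal is known only at interior points, so the maximum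
    has to be moved inside. If no interior point attained it, the sign identity would force
    \<open>\<kappa> x0 y = 0\<close> for almost every \<open>y\<close>, hence
    \<open>\<alpha> x0 * h x0 = 0\<close>.\<close>
  have "\<exists>x1\<in>{0<..<1}. \<bar>h x1\<bar> = \<bar>h x0\<bar>"
  proof (rule ccontr)
    assume none: "\<not> ?thesis"
    have sign: "AE y in lborel. y \<in> {0<..<1} \<longrightarrow> sgn (h x0) * (\<kappa> x0 y * h y) = \<bar>h x0\<bar> * \<bar>\<kappa> x0 y\<bar>"
      by (rule AE_sign_at_maximum[OF h eq[OF x0] x0]) (rule max)
    have "kappa.K h x0 = (LINT y :: real|lborel. 0)"
      unfolding kappa.K_def set_lebesgue_integral_def
    proof (rule integral_cong_AE)
      show "AE y in lborel. indicator {0..1} y *\<^sub>R (\<kappa> x0 y * h y) = 0"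
        using sign AE_indicator_unit_Icc_Ioo
      proof eventually_elim
        case (elim y)
        have "\<kappa> x0 y = 0" if y: "y \<in> {0<..<1}"
        proof (rule ccontr)
          assume "\<kappa> x0 y \<noteq> 0"
          have "\<bar>sgn (h x0) * (\<kappa> x0 y * h y)\<bar> = \<bar>\<bar>h x0\<bar> * \<bar>\<kappa> x0 y\<bar>\<bar>"
            using elim(1) y by simp
          then have "\<bar>h y\<bar> = \<bar>h x0\<bar>"
            using nz \<open>\<kappa> x0 y \<noteq> 0\<close> by (simp add: abs_mult abs_sgn_eq)
          then show False using none y by blast
        qed
        then show ?case using elim(2) by (auto simp: indicator_def)
      qed
      show "(\<lambda>y. indicator {0..1} y *\<^sub>R (\<kappa> x0 y * h y)) \<in> borel_measurable lborel"
        using kappa.integrable_k[OF x0 borel_integrable_atLeastAtMost'[OF h]]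
        by (auto simp: set_integrable_def dest: borel_measurable_integrable)
    qed simp
    then show False
      using eq[OF x0] alpha_pos[OF x0] nz by simp
  qed
  then obtain x1 where x1: "x1 \<in> {0<..<1}" and abs_x1: "\<bar>h x1\<bar> = \<bar>h x0\<bar>" by blast
  define m where "m = h x1"
  have m: "m \<noteq> 0" using abs_x1 nz by (auto simp: m_def)
  have const_Ioo: "h y = m" if y: "y \<in> {0<..<1}" for y
  proof (rule ccontr)
    assume "h y \<noteq> m"
    \<comment> \<open>Connectedness: \<open>?A\<close> is open since \<open>h\<close> is locally
      constant at each of its points, all of them maxima of \<open>|h|\<close>; \<open>?B\<close> is
      open by continuity.\<close>
    let ?A = "{z \<in> {0<..<1}. h z = m}" and ?B = "{z \<in> {0<..<1}. h z \<noteq> m}"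
    have "open ?A"
    proof (rule openI)
      fix z assume "z \<in> ?A"
      then have z: "z \<in> {0<..<1}" and hz: "h z = m" by auto
      have "\<exists>e>0. \<forall>y. \<bar>y - z\<bar> < e \<longrightarrow> h y = h z"
      proof (rule locally_constant_at_maximum[OF h _ z])
        show "\<alpha> z * h z = kappa.K h z"
          using z by (intro eq) simp
        show "\<bar>h y\<bar> \<le> \<bar>h z\<bar>" if "y \<in> {0..1}" for y
          using max[OF that] abs_x1 hz by (simp add: m_def)
        show "h z \<noteq> 0" using hz m by simp
      qed
      then obtain e where e: "0 < e" "\<forall>y. \<bar>y - z\<bar> < e \<longrightarrow> h y = m"
        unfolding hz by blast
      obtain d where d: "0 < d" "ball z d \<subseteq> {0<..<1}"
        using openE[OF open_greaterThanLessThan z] .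
      show "\<exists>T>0. ball z T \<subseteq> ?A"
        using e d by (intro exI[of _ "min e d"]) (auto simp: dist_real_def abs_minus_commute subset_iff)
    qed
    moreover have "open ?B"
    proof -
      have "continuous_on {0<..<1} h"
        using h by (rule continuous_on_subset) auto
      then have "open (h -` (- {m}) \<inter> {0<..<1})"
        by (intro continuous_on_open_vimage[THEN iffD1, rule_format]) auto
      also have "h -` (- {m}) \<inter> {0<..<1} = ?B" by auto
      finally show ?thesis .
    qed
    ultimately have "?A \<inter> {0<..<1} = {} \<or> ?B \<inter> {0<..<1} = {}"
      by (intro connectedD[OF connected_Ioo[of 0 1]]) auto
    then show False
      using x1 y \<open>h y \<noteq> m\<close> by (auto simp: m_def)
  qed
  have const: "h y = m" if "y \<in> {0..1}" for y
    using continuous_constant_on_closure[of "{0<..<1}" h m y] const_Ioo h that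
    by (simp add: closure_greaterThanLessThan)
  \<comment> \<open>A test point in the left boundary layer, where \<beta> is positive. For constant
    \<open>h\<close> the \<phi> term cancels against \<open>\<alpha> z\<close>, which leaves \<beta>
    times a positive integral equal to 0.\<close>
  define z where "z = \<delta> / 2"
  have z: "z \<in> {0..1}" "0 < z" "z < \<delta>" using delta by (auto simp: z_def)
  have "kappa.K h z = (LINT y:{0..1}|lborel. (\<phi> (z - y) - \<beta> z * near (z - y)) * m)"
    unfolding kappa.K_def \<kappa>_def by (intro set_lebesgue_integral_cong) (auto simp: const)
  also have "\<dots> = (\<alpha> z - \<beta> z * (LINT y:{0..1}|lborel. near (z - y))) * m"
    using phi.integrable_kernel[OF z(1)] near.integrable_kernel[OF z(1)]
    by (simp add: set_integral_diff \<alpha>_def)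
  finally have "\<beta> z * (LINT y:{0..1}|lborel. near (z - y)) = 0"
    using eq[OF z(1)] const[OF z(1)] m by (simp add: algebra_simps)
  moreover have "0 < \<beta> z"
    using z delta edge_pos[of z] edge_nonneg[of "1 - z"] by (simp add: \<beta>_def)
  moreover have "0 < (LINT y:{0..1}|lborel. near (z - y))"
    using near.integrable_kernel[OF z(1)] near_bounds z delta
    by (intro set_integral_pos[of _ _ 0 z]) (auto simp: near_def)
  ultimately show False by simp
qed

sublocale dominated_kernel \<kappa> bound \<alpha>
proof
  show "h x = 0" if "continuous_on {0..1} h" "\<And>x. x \<in> {0..1} \<Longrightarrow> \<alpha> x * h x = kappa.K h x" "x \<in> {0..1}" for h x
    using that by (rule strong_maximum_principle)
qed (use alpha_continuous alpha_pos kappa_dominated_closed in auto)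

end

section \<open>Transfer to the given kernel and operator\<close>

lemma A1_nonlocal_problem:
  assumes w: "A1 w" and d: "0 < \<delta>" "\<delta> < 1/2"
  shows "nonlocal_problem (\<lambda>z. w (\<bar>z\<bar> / \<delta>) / \<delta> ^ 3) \<delta>"
proof
  have cont: "continuous_on {0..<1} w" and nn: "\<And>r. 0 \<le> r \<Longrightarrow> 0 \<le> w r"
    and mono: "\<And>r s. 0 \<le> r \<Longrightarrow> r \<le> s \<Longrightarrow> s < 1 \<Longrightarrow> w s \<le> w r"
    and pos: "\<And>r. 0 < r \<Longrightarrow> r < 1 \<Longrightarrow> 0 < w r" and zero: "\<And>r. 1 \<le> r \<Longrightarrow> w r = 0"
    using w unfolding A1_def by auto
  \<comment> \<open>\<open>A1\<close> states positivity on the open interval only; at 0 it follows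
    from monotonicity by comparison with \<open>1/2\<close>.\<close>
  have pos0: "0 < w r" if "0 \<le> r" "r < 1" for r
    using pos[of r] pos[of "1/2"] mono[of 0 "1/2"] that by (cases "r = 0") auto
  show "0 < \<delta>" "\<delta> < 1/2" by fact+
  show "continuous_on {-\<delta><..<\<delta>} (\<lambda>z. w (\<bar>z\<bar> / \<delta>) / \<delta> ^ 3)"
    using d by (intro continuous_intros continuous_on_compose2[OF cont]) (auto simp: abs_less_iff)
  show "0 < w (\<bar>z\<bar> / \<delta>) / \<delta> ^ 3" if "\<bar>z\<bar> < \<delta>" for z
    using that d by (intro divide_pos_pos pos0) auto
  show "w (\<bar>z\<bar> / \<delta>) / \<delta> ^ 3 = 0" if "\<delta> \<le> \<bar>z\<bar>" for z
    using that d by (simp add: zero)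
  show "w (\<bar>z\<bar> / \<delta>) / \<delta> ^ 3 \<le> w (\<bar>y\<bar> / \<delta>) / \<delta> ^ 3" if "\<bar>y\<bar> \<le> \<bar>z\<bar>" for y z
  proof (cases "\<bar>z\<bar> < \<delta>")
    case True
    then show ?thesis
      using that d by (intro divide_right_mono mono) (auto simp: divide_right_mono)
  next
    case False
    then show ?thesis
      using d by (simp add: zero nn)
  qed
qed

theorem mainTheorem3:
  fixes w :: "real \<Rightarrow> real" and \<delta> :: real
  assumes "A1 w"
    and "0 < \<delta>" and "\<delta> < 1/2"
    and "A2 w \<delta>"
  shows "(\<forall>u\<in>L2. \<exists>g\<in>L2. ae_eq (Nt w \<delta> u) g)
    \<and> (\<exists>C>0. \<forall>f\<in>L2. \<exists>u\<in>L2. ae_eq (Nt w \<delta> u) f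
          \<and> (\<forall>v\<in>L2. ae_eq (Nt w \<delta> v) f \<longrightarrow> ae_eq v u)
          \<and> L2norm u \<le> C * L2norm f)"
proof -
  define \<phi> where "\<phi> z = w (\<bar>z\<bar> / \<delta>) / \<delta> ^ 3" for z
  interpret nonlocal_problem \<phi> \<delta>
    unfolding \<phi>_def[abs_def] using assms(1-3) by (rule A1_nonlocal_problem)
  have wd: "wd w \<delta> x y = \<phi> (x - y)" for x y
    by (simp add: wd_def \<phi>_def)
  have ad: "ad w \<delta> x = \<alpha> x" for x
    by (simp add: ad_def \<alpha>_def wd)
  \<comment> \<open>Both boundary integrals reduce to \<open>moment\<close>: here by
    \<open>y = x - z\<close>, at the right end by \<open>y = x + z\<close> and evenness of
    \<phi>.\<close>
  have left: "(LINT y:{x - \<delta>..0}|lborel. (x - y) * \<phi> (x - y)) = moment x" for x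
    unfolding moment_def set_lebesgue_integral_def
    by (subst lborel_integral_real_affine[where c = "-1" and t = x])
      (auto simp: indicator_def intro!: Bochner_Integration.integral_cong)
  have right: "(LINT y:{1..x + \<delta>}|lborel. (y - x) * \<phi> (x - y)) = moment (1 - x)" for x
    unfolding moment_def set_lebesgue_integral_def
    by (subst lborel_integral_real_affine[where c = 1 and t = x])
      (auto simp: indicator_def phi_minus intro!: Bochner_Integration.integral_cong)
  \<comment> \<open>Only on the open interval: at 0 and 1 \<open>bd\<close> is 0 by its default
    branch, whereas \<beta> is positive.\<close>
  have bd: "bd w \<delta> x = \<beta> x" if "x \<in> {0<..<1}" for x
    using that delta by (auto simp: bd_def wd left right \<beta>_def edge_eq_0 edge_def moment_eq_0)
  interpret dominated_nonlocal_problem \<phi> \<delta>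
  proof
    fix x :: real assume x: "x \<in> {0<..<1}"
    have "(LINT y:{0..1}|lborel. \<bar>\<kappa> x y\<bar>) = (LINT y:{0..1}|lborel. wtilde w \<delta> x y)"
      unfolding set_lebesgue_integral_def
    proof (rule integral_cong_AE)
      show "AE y in lborel. indicator {0..1} y *\<^sub>R \<bar>\<kappa> x y\<bar> = indicator {0..1} y *\<^sub>R wtilde w \<delta> x y"
        \<comment> \<open>\<open>wtilde\<close> cuts off with the open interval and \<kappa> with
          the closed one. They differ only at \<open>y = x\<close> and at distance \<delta>, so
          these three points are discarded.\<close>
        using AE_lborel_singleton[of x] AE_lborel_singleton[of "x - \<delta>"] AE_lborel_singleton[of "x + \<delta>"]
      proof eventually_elim
        case (elim y)
        then have "near (x - y) = indicator {0<..<\<delta>} \<bar>y - x\<bar>"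
          by (auto simp: near_def indicator_def)
        then show ?case
          by (simp add: wtilde_def \<kappa>_def wd bd[OF x])
      qed
      show "(\<lambda>y. indicator {0..1} y *\<^sub>R \<bar>\<kappa> x y\<bar>) \<in> borel_measurable lborel"
        unfolding \<kappa>_def by measurable
      show "(\<lambda>y. indicator {0..1} y *\<^sub>R wtilde w \<delta> x y) \<in> borel_measurable lborel"
        unfolding wtilde_def wd by measurable
    qed
    also have "\<dots> \<le> \<alpha> x"
      using \<open>A2 w \<delta>\<close> x by (simp add: A2_def ad)
    finally show "(LINT y:{0..1}|lborel. \<bar>\<kappa> x y\<bar>) \<le> \<alpha> x" .
  qed
  have Nt: "Nt w \<delta> u x = \<alpha> x * u x - kappa.K u x" if "x \<in> {0<..<1}" for u x
    using bd[OF that]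
    by (simp add: Nt_def kappa.K_def ad \<kappa>_def near_def wd mult.commute[of "u _"] abs_minus_commute)
  have Nt_ae: "ae_eq (Nt w \<delta> u) g \<longleftrightarrow> ae_eq (\<lambda>x. \<alpha> x * u x - kappa.K u x) g" for u g
    unfolding ae_eq_def using Nt by (intro eventually_subst always_eventually) auto
  have "\<exists>g\<in>L2. ae_eq (Nt w \<delta> u) g" if u: "u \<in> L2" for u
  proof -
    obtain g where "g \<in> L2" "\<forall>x\<in>{0..1}. \<alpha> x * u x - kappa.K u x = g x"
      using L2_stable[OF u] by blast
    then show ?thesis
      unfolding Nt_ae by (intro bexI[of _ g]) (auto simp: ae_eq_def)
  qed
  then show ?thesis
    using L2_solvable by (simp add: Nt_ae)
qed

end
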